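(* Let $R$ be a commutative domain with unit and let $f\in R$ be a nonzero non-invertible element. Let $S=R[u,v]/(uv-f)$, where $R[u,v]$ is the polynomial ring in two variables over $R$. Then $S$ is a unique factorization domain if and only if $R$ is a unique factorization domain and $f$ is a prime element of $R$. *)

theory Defs
  imports "HOL-Algebra.Algebra"
begin

text \<open>The polynomial ring R[u,v] in two variables, realised as (R[u])[v].\<close>

definition var_u :: "('a, 'm) ring_scheme \<Rightarrow> nat \<Rightarrow> nat \<Rightarrow> 'a" where
  "var_u R = monom (UP (UP R)) (monom (UP R) \<one>\<^bsub>R\<^esub> 1) 0"

definition var_v :: "('a, 'm) ring_scheme \<Rightarrow> nat \<Rightarrow> nat \<Rightarrow> 'a" where
  "var_v R = monom (UP (UP R)) \<one>\<^bsub>UP R\<^esub> 1"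

definition const2 :: "('a, 'm) ring_scheme \<Rightarrow> 'a \<Rightarrow> nat \<Rightarrow> nat \<Rightarrow> 'a" where
  "const2 R a = monom (UP (UP R)) (monom (UP R) a 0) 0"

definition S_ring :: "('a, 'm) ring_scheme \<Rightarrow> 'a \<Rightarrow> (nat \<Rightarrow> nat \<Rightarrow> 'a) set ring" where
  "S_ring R f = UP (UP R) Quot
     (PIdl\<^bsub>UP (UP R)\<^esub> (var_u R \<otimes>\<^bsub>UP (UP R)\<^esub> var_v R \<ominus>\<^bsub>UP (UP R)\<^esub> const2 R f))"

end

theory Submission
  imports Defs
begin

text \<open>
  The ring $S$ is graded by the integers with $u$ in degree $1$ and $v$ in degree $-1$: the component
  of degree $n$ is free of rank one over $R$, generated by $e_n = u^n$ or $e_n = v^{-n}$, and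
  $e_n e_m = f^c e_{n+m}$ where $c$ counts the cancelling pairs $uv$. Since factors of a homogeneous
  element of a graded domain are homogeneous, the units of $S$ are those of $R$, the element $u$ is
  irreducible, and so is every irreducible of $R$ that is not associated to $f$. If $S$ is factorial,
  these elements are prime in $S$; primality of $u$ in $S$ means primality of $f$ in $R$, and the
  remaining irreducibles of $R$ are prime because $R$ is the degree zero part of $S$.

  Conversely, if $R$ is factorial and $f$ is prime, every homogeneous non-unit of $S$ is divisible by
  one of the primes $u$, $v$ or $p$ ($p$ a prime of $R$ not associated to $f$). This suffices for any
  integer-graded domain with a length function on homogeneous elements: cross-multiplying by leading
  components is a Euclidean algorithm up to homogeneous factors, with the width of the support as
  Euclidean function, and an irreducible element without homogeneous prime divisors can be cancelled
  against homogeneous factors.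
\<close>

subsection \<open>Domains graded by the integers\<close>

text \<open>A direct sum decomposition is encoded by additive projections \<open>pr n\<close>
  together with the induction principle \<open>H_generate\<close>, in place of families of
  components. Absence of zero divisors is demanded of homogeneous elements; that \<open>S\<close> is
  a domain then follows by comparing top components.\<close>

locale int_graded_cring = cring S for S (structure) +
  fixes H :: "int \<Rightarrow> 'a set" and pr :: "int \<Rightarrow> 'a \<Rightarrow> 'a"
  assumes H_carrier: "H n \<subseteq> carrier S"
    and H_mult: "\<lbrakk>h \<in> H n; k \<in> H m\<rbrakk> \<Longrightarrow> h \<otimes> k \<in> H (n + m)"
    and H_integral: "\<lbrakk>h \<in> H n; k \<in> H m; h \<otimes> k = \<zero>\<rbrakk> \<Longrightarrow> h = \<zero> \<or> k = \<zero>"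
    and one_H: "\<one> \<in> H 0"
    and one_neq_zero: "\<one> \<noteq> \<zero>"
    and pr_H: "x \<in> carrier S \<Longrightarrow> pr n x \<in> H n"
    and pr_add: "\<lbrakk>x \<in> carrier S; y \<in> carrier S\<rbrakk> \<Longrightarrow> pr n (x \<oplus> y) = pr n x \<oplus> pr n y"
    and pr_homogeneous: "h \<in> H n \<Longrightarrow> pr m h = (if m = n then h else \<zero>)"
    and H_generate: "\<lbrakk>x \<in> carrier S; \<And>n h. h \<in> H n \<Longrightarrow> h \<in> Q;
      \<And>y z. \<lbrakk>y \<in> Q; z \<in> Q\<rbrakk> \<Longrightarrow> y \<oplus> z \<in> Q\<rbrakk> \<Longrightarrow> x \<in> Q"
begin

lemma H_closed: "h \<in> H n \<Longrightarrow> h \<in> carrier S"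
  using H_carrier by auto

lemma pr_closed [simp, intro]: "x \<in> carrier S \<Longrightarrow> pr n x \<in> carrier S"
  using pr_H H_closed by blast

lemma pr_zero [simp]: "pr n \<zero> = \<zero>"
  using pr_add[of \<zero> \<zero> n] pr_closed[of \<zero> n]
  by (metis add.l_cancel_one' r_zero zero_closed)

lemma pr_a_inv [simp]:
  assumes "x \<in> carrier S"
  shows "pr n (\<ominus> x) = \<ominus> pr n x"
proof -
  have "pr n (\<ominus> x) \<oplus> pr n x = \<zero>"
    using pr_add[of "\<ominus> x" x n] assms by (simp add: l_neg)
  then show ?thesis
    using assms by (simp add: minus_equality)
qed

lemma pr_minus: "\<lbrakk>x \<in> carrier S; y \<in> carrier S\<rbrakk> \<Longrightarrow> pr n (x \<ominus> y) = pr n x \<ominus> pr n y"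
  by (simp add: a_minus_def pr_add)

lemma pr_pr: "x \<in> carrier S \<Longrightarrow> pr m (pr n x) = (if m = n then pr n x else \<zero>)"
  using pr_homogeneous pr_H by blast

section \<open>Supports and decomposition into components\<close>

definition supp :: "'a \<Rightarrow> int set" where
  "supp x = {n. pr n x \<noteq> \<zero>}"

lemma finite_supp:
  assumes "x \<in> carrier S"
  shows "finite (supp x)"
proof -
  have "x \<in> {x \<in> carrier S. finite (supp x)}"
  proof (rule H_generate[OF assms])
    fix n h assume h: "h \<in> H n"
    then have "supp h \<subseteq> {n}"
      by (auto simp: supp_def pr_homogeneous)
    then show "h \<in> {x \<in> carrier S. finite (supp x)}"
      using h H_closed by (auto intro: finite_subset)
  next
    fix y z assume yz: "y \<in> {x \<in> carrier S. finite (supp x)}" "z \<in> {x \<in> carrier S. finite (supp x)}"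
    then have "supp (y \<oplus> z) \<subseteq> supp y \<union> supp z"
      by (auto simp: supp_def pr_add)
    then show "y \<oplus> z \<in> {x \<in> carrier S. finite (supp x)}"
      using yz by (auto intro: finite_subset)
  qed
  then show ?thesis by simp
qed

text \<open>The formula is asked of every finite \<open>B\<close> containing some finite
  \<open>A\<close>, because the induction over sums has to pass to a common index set, the union of
  the two.\<close>

lemma sum_pr:
  assumes "x \<in> carrier S"
  shows "\<exists>A. finite A \<and> (\<forall>B. finite B \<longrightarrow> A \<subseteq> B \<longrightarrow> x = (\<Oplus>n\<in>B. pr n x))"
proof -
  let ?Q = "{x \<in> carrier S. \<exists>A. finite A \<and> (\<forall>B. finite B \<longrightarrow> A \<subseteq> B \<longrightarrow> x = (\<Oplus>n\<in>B. pr n x))}"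
  have "x \<in> ?Q"
  proof (rule H_generate[OF assms])
    fix n h assume h: "h \<in> H n"
    have "h = (\<Oplus>m\<in>B. pr m h)" if "finite B" "{n} \<subseteq> B" for B
    proof -
      have "(\<Oplus>m\<in>B. pr m h) = (\<Oplus>m\<in>B. if n = m then h else \<zero>)"
        by (rule finsum_cong') (auto simp: pr_homogeneous[OF h] H_closed[OF h])
      also have "\<dots> = h"
        using finsum_singleton[of n B "\<lambda>_. h"] that H_closed[OF h] by simp
      finally show ?thesis by simp
    qed
    then have "finite {n} \<and> (\<forall>B. finite B \<longrightarrow> {n} \<subseteq> B \<longrightarrow> h = (\<Oplus>m\<in>B. pr m h))"
      by (intro conjI allI impI) auto
    then show "h \<in> ?Q"
      by (intro CollectI conjI[OF H_closed[OF h]]) (rule exI)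
  next
    fix y z assume "y \<in> ?Q" "z \<in> ?Q"
    then obtain A B where y: "y \<in> carrier S" and z: "z \<in> carrier S" and AB: "finite A" "finite B"
      and A: "\<And>C. \<lbrakk>finite C; A \<subseteq> C\<rbrakk> \<Longrightarrow> y = (\<Oplus>n\<in>C. pr n y)"
      and B: "\<And>C. \<lbrakk>finite C; B \<subseteq> C\<rbrakk> \<Longrightarrow> z = (\<Oplus>n\<in>C. pr n z)"
      by blast
    have "y \<oplus> z = (\<Oplus>n\<in>C. pr n (y \<oplus> z))" if C: "finite C" "A \<union> B \<subseteq> C" for C
    proof -
      have "(\<Oplus>n\<in>C. pr n (y \<oplus> z)) = (\<Oplus>n\<in>C. pr n y \<oplus> pr n z)"
        using y z by (simp add: pr_add)
      also have "\<dots> = (\<Oplus>n\<in>C. pr n y) \<oplus> (\<Oplus>n\<in>C. pr n z)"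
        using y z by (simp add: finsum_addf Pi_def)
      finally show ?thesis
        using A[of C, symmetric] B[of C, symmetric] C by simp
    qed
    then have "finite (A \<union> B) \<and> (\<forall>C. finite C \<longrightarrow> A \<union> B \<subseteq> C \<longrightarrow> y \<oplus> z = (\<Oplus>n\<in>C. pr n (y \<oplus> z)))"
      using AB by (intro conjI allI impI) auto
    then show "y \<oplus> z \<in> ?Q"
      by (intro CollectI conjI[OF a_closed[OF y z]]) (rule exI)
  qed
  then show ?thesis by blast
qed

lemma supp_empty_iff:
  assumes x: "x \<in> carrier S"
  shows "supp x = {} \<longleftrightarrow> x = \<zero>"
proof
  assume "supp x = {}"
  then have pr0: "pr n x = \<zero>" for n
    by (auto simp: supp_def)
  obtain B where "x = (\<Oplus>n\<in>B. pr n x)"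
    using sum_pr[OF x] by blast
  also have "\<dots> = \<zero>"
    by (simp only: pr0 finsum_zero)
  finally show "x = \<zero>" .
qed (simp add: supp_def)

lemma pr_minus_pr:
  assumes x: "x \<in> carrier S"
  shows "pr m (x \<ominus> pr n x) = (if m = n then \<zero> else pr m x)"
proof -
  have "pr m (x \<ominus> pr n x) = pr m x \<oplus> \<ominus> (if m = n then pr n x else \<zero>)"
    using pr_minus[of x "pr n x" m] pr_pr[OF x, of m n] x by (simp add: minus_eq)
  then show ?thesis
    using x by (simp add: r_neg)
qed

lemma supp_minus_pr: "x \<in> carrier S \<Longrightarrow> supp (x \<ominus> pr n x) = supp x - {n}"
  by (auto simp: supp_def pr_minus_pr)

text \<open>Removing the component of a degree in the support shrinks the finite support by one
  element, so the induction runs on its cardinality.\<close>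

lemma supp_induct [consumes 1, case_names zero step]:
  assumes "x \<in> carrier S"
    and "P \<zero>"
    and "\<And>x n. \<lbrakk>x \<in> carrier S; n \<in> supp x; P (x \<ominus> pr n x)\<rbrakk> \<Longrightarrow> P x"
  shows "P x"
  using assms(1)
proof (induction "card (supp x)" arbitrary: x rule: less_induct)
  case less
  show ?case
  proof (cases "x = \<zero>")
    case False
    then obtain n where n: "n \<in> supp x"
      using supp_empty_iff less.prems by blast
    have "card (supp (x \<ominus> pr n x)) < card (supp x)"
      using n finite_supp[OF less.prems] unfolding supp_minus_pr[OF less.prems] by (simp only: card_Diff1_less)
    then have "P (x \<ominus> pr n x)"
      using less.hyps less.prems by simp
    then show ?thesis
      using assms(3) less.prems n by blast
  qed (simp add: assms(2))
qed

lemma minus_pr_add: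
  "x \<in> carrier S \<Longrightarrow> x = pr n x \<oplus> (x \<ominus> pr n x)"
  using pr_closed[of x n] by (metis a_comm add.inv_solve_right' minus_closed minus_eq)

lemma pr_homogeneous_mult:
  assumes h: "h \<in> H n" and x: "x \<in> carrier S"
  shows "pr m (h \<otimes> x) = h \<otimes> pr (m - n) x"
proof -
  have "x \<in> {x \<in> carrier S. pr m (h \<otimes> x) = h \<otimes> pr (m - n) x}"
  proof (rule H_generate[OF x])
    fix k g assume g: "g \<in> H k"
    then show "g \<in> {x \<in> carrier S. pr m (h \<otimes> x) = h \<otimes> pr (m - n) x}"
      using h by (auto simp: H_closed pr_homogeneous[OF g] pr_homogeneous[OF H_mult[OF h g]])
  qed (use h in \<open>auto simp: H_closed r_distr pr_add\<close>)
  then show ?thesis by simp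
qed

text \<open>\<open>t\<close> and \<open>s\<close> are upper bounds of the degrees that may fail to
  be attained, so the assumption survives the removal of a component from \<open>x\<close>. A
  removed component of degree \<open>n < t\<close> contributes nothing in degree
  \<open>t + s\<close>, because \<open>y\<close> has no component in degree
  \<open>t + s - n > s\<close>.\<close>

lemma pr_mult_top:
  assumes "x \<in> carrier S" and y: "y \<in> carrier S"
    and "\<And>k. k > t \<Longrightarrow> pr k x = \<zero>" and s: "\<And>k. k > s \<Longrightarrow> pr k y = \<zero>"
  shows "pr (t + s) (x \<otimes> y) = pr t x \<otimes> pr s y \<and> (\<forall>k > t + s. pr k (x \<otimes> y) = \<zero>)"
  using assms(1,3)
proof (induction rule: supp_induct)
  case zero
  then show ?case using y by simp
next
  case (step x n)
  let ?h = "pr n x" and ?r = "x \<ominus> pr n x"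
  have h: "?h \<in> H n" and c: "?h \<in> carrier S" "?r \<in> carrier S"
    using step.hyps pr_H by auto
  have n: "n \<le> t"
    using step.hyps(2) step.prems[of n] by (fastforce simp: supp_def)
  have r: "pr (t + s) (?r \<otimes> y) = pr t ?r \<otimes> pr s y \<and> (\<forall>k > t + s. pr k (?r \<otimes> y) = \<zero>)"
    by (rule step.IH) (use step.hyps step.prems in \<open>simp add: pr_minus_pr\<close>)
  have "x \<otimes> y = ?h \<otimes> y \<oplus> ?r \<otimes> y"
    unfolding l_distr[OF c y, symmetric] minus_pr_add[OF step.hyps(1), of n, symmetric] ..
  then have eq: "pr k (x \<otimes> y) = ?h \<otimes> pr (k - n) y \<oplus> pr k (?r \<otimes> y)" for k
    using c y by (simp add: pr_add pr_homogeneous_mult[OF h])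
  have "pr (t + s) (x \<otimes> y) = pr t x \<otimes> pr s y"
  proof (cases "n = t")
    case True
    then have "pr t ?r = \<zero>"
      using step.hyps by (simp add: pr_minus_pr)
    then show ?thesis
      using True r c y by (simp add: eq)
  next
    case False
    then have "pr t ?r = pr t x" "pr (t + s - n) y = \<zero>"
      using step.hyps n s by (simp_all add: pr_minus_pr)
    then show ?thesis
      using r c y step.hyps by (simp add: eq)
  qed
  moreover have "pr k (x \<otimes> y) = \<zero>" if "k > t + s" for k
    using r that n c s[of "k - n"] by (simp add: eq)
  ultimately show ?case by blast
qed

text \<open>Reversing the grading turns statements on top degrees into statements on bottom
  degrees.\<close>

lemma int_graded_cring_uminus: "int_graded_cring S (\<lambda>n. H (- n)) (\<lambda>n. pr (- n))"
proof
  show "h \<otimes> k \<in> H (- (n + m))" if "h \<in> H (- n)" "k \<in> H (- m)" for h k n m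
    using H_mult[OF that] by (simp add: algebra_simps)
  show "\<one> \<in> H (- 0)"
    using one_H by simp
  show "x \<in> Q" if "x \<in> carrier S" "\<And>n h. h \<in> H (- n) \<Longrightarrow> h \<in> Q"
    "\<And>y z. \<lbrakk>y \<in> Q; z \<in> Q\<rbrakk> \<Longrightarrow> y \<oplus> z \<in> Q" for x Q
  proof (rule H_generate[OF that(1)])
    show "h \<in> Q" if "h \<in> H n" for n h
      using that \<open>\<And>n h. h \<in> H (- n) \<Longrightarrow> h \<in> Q\<close>[of h "- n"] by simp
  qed (use that(3) in blast)
qed (simp_all add: H_carrier one_neq_zero pr_H pr_add pr_homogeneous, fact H_integral)

section \<open>Top degree, bottom degree and width\<close>

definition tdeg :: "'a \<Rightarrow> int" where "tdeg x = Max (supp x)"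
definition bdeg :: "'a \<Rightarrow> int" where "bdeg x = Min (supp x)"

lemma
  assumes "x \<in> carrier S" "x \<noteq> \<zero>"
  shows pr_tdeg: "pr (tdeg x) x \<noteq> \<zero>" and pr_above_tdeg: "k > tdeg x \<Longrightarrow> pr k x = \<zero>"
    and pr_bdeg: "pr (bdeg x) x \<noteq> \<zero>" and pr_below_bdeg: "k < bdeg x \<Longrightarrow> pr k x = \<zero>"
    and bdeg_le_tdeg: "bdeg x \<le> tdeg x"
proof -
  have fin: "finite (supp x)" and ne: "supp x \<noteq> {}"
    using finite_supp supp_empty_iff assms by auto
  from Max_in[OF this] show "pr (tdeg x) x \<noteq> \<zero>"
    by (simp add: supp_def tdeg_def)
  from Min_in[OF fin ne] show "pr (bdeg x) x \<noteq> \<zero>"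
    by (simp add: supp_def bdeg_def)
  show "pr k x = \<zero>" if "k > tdeg x"
    using Max_ge[OF fin, of k] that by (auto simp: supp_def tdeg_def)
  show "pr k x = \<zero>" if "k < bdeg x"
    using Min_le[OF fin, of k] that by (auto simp: supp_def bdeg_def)
  show "bdeg x \<le> tdeg x"
    using Max_ge[OF fin Min_in[OF fin ne]] by (simp add: tdeg_def bdeg_def)
qed

lemma tdegI:
  assumes "x \<in> carrier S" "pr n x \<noteq> \<zero>" "\<And>k. k > n \<Longrightarrow> pr k x = \<zero>"
  shows "tdeg x = n"
  unfolding tdeg_def using assms finite_supp
  by (intro Max_eqI) (auto simp: supp_def not_less[symmetric])

lemma bdegI:
  assumes "x \<in> carrier S" "pr n x \<noteq> \<zero>" "\<And>k. k < n \<Longrightarrow> pr k x = \<zero>"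
  shows "bdeg x = n"
  unfolding bdeg_def using assms finite_supp
  by (intro Min_eqI) (auto simp: supp_def not_less[symmetric])

text \<open>The product of the top components is the top component of the product, and
  \<open>H_integral\<close> keeps it from vanishing; in particular there are no zero divisors. The
  bottom degree is treated by \<open>pr_mult_top\<close> for the reversed grading.\<close>

lemma
  assumes x: "x \<in> carrier S" "x \<noteq> \<zero>" and y: "y \<in> carrier S" "y \<noteq> \<zero>"
  shows tdeg_mult: "tdeg (x \<otimes> y) = tdeg x + tdeg y"
    and pr_tdeg_mult: "pr (tdeg x + tdeg y) (x \<otimes> y) = pr (tdeg x) x \<otimes> pr (tdeg y) y"
    and bdeg_mult: "bdeg (x \<otimes> y) = bdeg x + bdeg y"
    and mult_neq_zero: "x \<otimes> y \<noteq> \<zero>"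
proof -
  have t: "pr (tdeg x + tdeg y) (x \<otimes> y) = pr (tdeg x) x \<otimes> pr (tdeg y) y"
    "\<And>k. k > tdeg x + tdeg y \<Longrightarrow> pr k (x \<otimes> y) = \<zero>"
    using pr_mult_top[OF x(1) y(1), of "tdeg x" "tdeg y"] pr_above_tdeg x y by auto
  have nz: "pr (tdeg x) x \<otimes> pr (tdeg y) y \<noteq> \<zero>"
    using H_integral[OF pr_H[OF x(1)] pr_H[OF y(1)]] pr_tdeg x y by blast
  show "pr (tdeg x + tdeg y) (x \<otimes> y) = pr (tdeg x) x \<otimes> pr (tdeg y) y"
    by (fact t)
  show "tdeg (x \<otimes> y) = tdeg x + tdeg y"
    using t nz x y by (intro tdegI) auto
  show "x \<otimes> y \<noteq> \<zero>"
    using t nz by force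
  interpret neg: int_graded_cring S "\<lambda>n. H (- n)" "\<lambda>n. pr (- n)"
    by (rule int_graded_cring_uminus)
  have b: "pr (bdeg x + bdeg y) (x \<otimes> y) = pr (bdeg x) x \<otimes> pr (bdeg y) y"
    "\<And>k. k < bdeg x + bdeg y \<Longrightarrow> pr k (x \<otimes> y) = \<zero>"
  proof -
    have *: "pr (- (- bdeg x + - bdeg y)) (x \<otimes> y) = pr (- (- bdeg x)) x \<otimes> pr (- (- bdeg y)) y \<and>
        (\<forall>k > - bdeg x + - bdeg y. pr (- k) (x \<otimes> y) = \<zero>)"
      by (rule neg.pr_mult_top) (use x y in \<open>auto intro: pr_below_bdeg\<close>)
    show "pr (bdeg x + bdeg y) (x \<otimes> y) = pr (bdeg x) x \<otimes> pr (bdeg y) y"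
      using * by (simp add: add.commute)
    show "pr k (x \<otimes> y) = \<zero>" if "k < bdeg x + bdeg y" for k
      using conjunct2[OF *, THEN spec, of "- k"] that by simp
  qed
  have "pr (bdeg x) x \<otimes> pr (bdeg y) y \<noteq> \<zero>"
    using H_integral[OF pr_H[OF x(1)] pr_H[OF y(1)]] pr_bdeg x y by blast
  then show "bdeg (x \<otimes> y) = bdeg x + bdeg y"
    using b x y by (intro bdegI) auto
qed

sublocale domain S
  using one_neq_zero mult_neq_zero by unfold_locales auto

definition width :: "'a \<Rightarrow> nat" where "width x = nat (tdeg x - bdeg x)"

lemma width_mult:
  "\<lbrakk>x \<in> carrier S; x \<noteq> \<zero>; y \<in> carrier S; y \<noteq> \<zero>\<rbrakk> \<Longrightarrow> width (x \<otimes> y) = width x + width y"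
  using bdeg_le_tdeg[of x] bdeg_le_tdeg[of y] by (simp add: width_def tdeg_mult bdeg_mult)

lemma width_eq_0_iff:
  assumes x: "x \<in> carrier S" "x \<noteq> \<zero>"
  shows "width x = 0 \<longleftrightarrow> (\<exists>n. x \<in> H n)"
proof
  assume "width x = 0"
  then have eq: "bdeg x = tdeg x"
    using bdeg_le_tdeg[OF x] by (simp add: width_def)
  have "supp x \<subseteq> {tdeg x}"
    using pr_above_tdeg[OF x] pr_below_bdeg[OF x] unfolding supp_def eq
    by (metis (mono_tags, lifting) insertI1 linorder_neqE mem_Collect_eq subsetI)
  then have "x \<ominus> pr (tdeg x) x = \<zero>"
    using supp_minus_pr[OF x(1)] supp_empty_iff x by (metis Diff_eq_empty_iff minus_closed pr_closed)
  then show "\<exists>n. x \<in> H n"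
    using pr_H[OF x(1)] x by (metis pr_closed r_right_minus_eq)
next
  assume "\<exists>n. x \<in> H n"
  then obtain n where n: "x \<in> H n" ..
  have "tdeg x = n" "bdeg x = n"
    using x by (auto intro!: tdegI bdegI simp: pr_homogeneous[OF n])
  then show "width x = 0" by (simp add: width_def)
qed

section \<open>Homogeneous elements and divisibility\<close>

definition homogeneous :: "'a \<Rightarrow> bool" where
  "homogeneous x \<longleftrightarrow> x \<noteq> \<zero> \<and> (\<exists>n. x \<in> H n)"

lemma homogeneous_closed: "homogeneous x \<Longrightarrow> x \<in> carrier S"
  using H_closed by (auto simp: homogeneous_def)

lemma homogeneous_neq_zero: "homogeneous x \<Longrightarrow> x \<noteq> \<zero>"
  by (simp add: homogeneous_def)

lemma homogeneous_one: "homogeneous \<one>"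
  using one_H by (auto simp: homogeneous_def)

lemma homogeneous_pr_tdeg: "\<lbrakk>x \<in> carrier S; x \<noteq> \<zero>\<rbrakk> \<Longrightarrow> homogeneous (pr (tdeg x) x)"
  using pr_tdeg pr_H by (auto simp: homogeneous_def)

text \<open>Width is additive, and among nonzero elements width 0 means homogeneous; a sum of two
  natural numbers vanishes only if both do.\<close>

lemma homogeneous_mult_iff:
  assumes "x \<in> carrier S" "y \<in> carrier S"
  shows "homogeneous (x \<otimes> y) \<longleftrightarrow> homogeneous x \<and> homogeneous y"
proof (cases "x = \<zero> \<or> y = \<zero>")
  case False
  then show ?thesis
    using assms width_eq_0_iff[of x] width_eq_0_iff[of y] width_eq_0_iff[of "x \<otimes> y"] width_mult[of x y]
      mult_neq_zero[of x y] by (auto simp: homogeneous_def)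
qed (use assms in \<open>auto simp: homogeneous_def\<close>)


lemma divides_add: "\<lbrakk>c \<in> carrier S; x \<in> carrier S; y \<in> carrier S; c divides x; c divides y\<rbrakk> \<Longrightarrow> c divides (x \<oplus> y)"
  unfolding factor_def by (metis a_closed r_distr)

lemma divides_minus: "\<lbrakk>c \<in> carrier S; x \<in> carrier S; y \<in> carrier S; c divides x; c divides y\<rbrakk> \<Longrightarrow> c divides (x \<ominus> y)"
  unfolding factor_def by (metis a_inv_closed a_minus_def r_distr r_minus a_closed)

lemma divides_pr:
  assumes "p \<in> H n" "x \<in> carrier S" "p divides x"
  shows "p divides pr m x"
proof -
  obtain y where y: "y \<in> carrier S" "x = p \<otimes> y"
    using assms(3) by (auto simp: factor_def)
  then have "pr m x = p \<otimes> pr (m - n) y"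
    by (simp add: pr_homogeneous_mult[OF assms(1)])
  then show ?thesis
    using y by auto
qed

section \<open>Primality tested on homogeneous elements\<close>

definition graded_prime :: "'a \<Rightarrow> bool" where
  "graded_prime p \<longleftrightarrow> homogeneous p \<and> p \<notin> Units S \<and>
    (\<forall>h k. homogeneous h \<longrightarrow> homogeneous k \<longrightarrow> p divides (h \<otimes> k) \<longrightarrow> p divides h \<or> p divides k)"

text \<open>Since \<open>p\<close> is homogeneous it divides the top component of
  \<open>a \<otimes> b\<close>, hence the top component of \<open>a\<close> or of \<open>b\<close>.
  Subtracting that component keeps the product divisible by \<open>p\<close> and shrinks one of the
  supports.\<close>

lemma graded_prime_divides_mult:
  assumes p: "graded_prime p"
    and "a \<in> carrier S" "b \<in> carrier S" "p divides (a \<otimes> b)"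
  shows "p divides a \<or> p divides b"
  using assms(2-)
proof (induction "card (supp a) + card (supp b)" arbitrary: a b rule: less_induct)
  case less
  have pc: "p \<in> carrier S"
    using p homogeneous_closed by (auto simp: graded_prime_def)
  \<comment> \<open>Stated for \<open>x\<close> and \<open>y\<close> because it is applied to
    \<open>a\<close>, \<open>b\<close> in both orders.\<close>
  have step: "p divides x \<or> p divides y"
    if x: "x \<in> carrier S" "x \<noteq> \<zero>" and y: "y \<in> carrier S" and xy: "p divides (x \<otimes> y)"
      and h: "p divides pr (tdeg x) x" and c: "card (supp x) + card (supp y) = card (supp a) + card (supp b)" for x y
  proof -
    let ?h = "pr (tdeg x) x"
    have hc: "?h \<in> carrier S"
      using x by simp
    have "card (supp (x \<ominus> ?h)) < card (supp x)"
      using pr_tdeg[OF x] finite_supp[OF x(1)] unfolding supp_minus_pr[OF x(1)]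
      by (intro card_Diff1_less) (auto simp: supp_def)
    moreover have "p divides (x \<ominus> ?h) \<otimes> y"
    proof -
      have "(x \<ominus> ?h) \<otimes> y = x \<otimes> y \<ominus> ?h \<otimes> y"
        using x hc y by algebra
      moreover have "p divides ?h \<otimes> y"
        using h pc hc y by (simp add: divides_prod_r)
      ultimately show ?thesis
        using divides_minus[OF pc _ _ xy] x hc y by simp
    qed
    ultimately have "p divides (x \<ominus> ?h) \<or> p divides y"
      using less.hyps[of "x \<ominus> ?h" y] x y c by simp
    then show ?thesis
      using divides_add[OF pc hc _ h, of "x \<ominus> ?h"] minus_pr_add[OF x(1), of "tdeg x"] x hc by auto
  qed
  show ?case
  proof (cases "a = \<zero> \<or> b = \<zero>")
    case True
    then show ?thesis using divides_zero[OF pc] by auto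
  next
    case False
    obtain n where n: "p \<in> H n"
      using p by (auto simp: graded_prime_def homogeneous_def)
    have "p divides (pr (tdeg a) a \<otimes> pr (tdeg b) b)"
      using divides_pr[OF n _ less.prems(3), of "tdeg a + tdeg b"] pr_tdeg_mult False less.prems by simp
    then have "p divides pr (tdeg a) a \<or> p divides pr (tdeg b) b"
      using p homogeneous_pr_tdeg False less.prems by (auto simp: graded_prime_def)
    then show ?thesis
    proof
      assume "p divides pr (tdeg a) a"
      then show ?thesis using step[of a b] False less.prems by simp
    next
      assume "p divides pr (tdeg b) b"
      then show ?thesis using step[of b a] False less.prems by (simp add: m_comm add.commute disj_commute)
    qed
  qed
qed

lemma graded_prime_imp_prime: "graded_prime p \<Longrightarrow> prime S p"
  using graded_prime_divides_mult by (intro primeI) (auto simp: graded_prime_def)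

section \<open>Euclidean algorithm up to homogeneous factors\<close>

text \<open>The two products have the same top component, which cancels, so a nonzero
  \<open>r\<close> has top degree below \<open>tdeg x + tdeg d\<close>. By \<open>le\<close> neither
  product has components below degree \<open>tdeg d + bdeg x\<close>. Hence
  \<open>tdeg r - bdeg r < tdeg x - bdeg x\<close>.\<close>

lemma cross_mult_reduces_width:
  assumes x: "x \<in> carrier S" "x \<noteq> \<zero>" and d: "d \<in> carrier S" "d \<noteq> \<zero>" and le: "width d \<le> width x"
  defines "r \<equiv> pr (tdeg d) d \<otimes> x \<ominus> pr (tdeg x) x \<otimes> d"
  shows "r = \<zero> \<or> width r < width x"
proof (rule disjCI)
  assume "\<not> width r < width x"
  show "r = \<zero>"
  proof (rule ccontr)
    assume r0: "r \<noteq> \<zero>"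
    have rc: "r \<in> carrier S"
      using x d by (simp add: r_def)
    have pr_r: "pr k r = pr (tdeg d) d \<otimes> pr (k - tdeg d) x \<ominus> pr (tdeg x) x \<otimes> pr (k - tdeg x) d" for k
      using x d pr_H by (simp add: r_def pr_minus pr_homogeneous_mult[of _ "tdeg d"] pr_homogeneous_mult[of _ "tdeg x"])
    have "\<not> tdeg r \<ge> tdeg x + tdeg d"
    proof
      assume "tdeg r \<ge> tdeg x + tdeg d"
      then consider "tdeg r = tdeg x + tdeg d" | "tdeg r > tdeg x + tdeg d"
        by linarith
      then have "pr (tdeg r) r = \<zero>"
      proof cases
        case 1
        then show ?thesis
          using x d by (simp add: pr_r m_comm a_minus_def r_neg)
      next
        case 2
        then show ?thesis
          using x d by (simp add: pr_r pr_above_tdeg a_minus_def)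
      qed
      then show False
        using pr_tdeg rc r0 by blast
    qed
    moreover have "\<not> bdeg r < tdeg d + bdeg x"
    proof
      assume "bdeg r < tdeg d + bdeg x"
      moreover have "tdeg d + bdeg x \<le> tdeg x + bdeg d"
        using le bdeg_le_tdeg[OF x] bdeg_le_tdeg[OF d] by (simp add: width_def)
      ultimately have "pr (bdeg r) r = \<zero>"
        using x d by (simp add: pr_r pr_below_bdeg a_minus_def)
      then show False
        using pr_bdeg rc r0 by blast
    qed
    ultimately show False
      using \<open>\<not> width r < width x\<close> bdeg_le_tdeg[OF x] bdeg_le_tdeg[OF rc r0] by (simp add: width_def)
  qed
qed

text \<open>Division with remainder, where each step multiplies \<open>x\<close> by the top
  component of \<open>d\<close>; these factors accumulate in \<open>w\<close>. All remainders stay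
  in \<open>J\<close>, so minimality of \<open>d\<close> supplies the comparison of widths for
  \<open>cross_mult_reduces_width\<close>.\<close>

lemma min_width_divides:
  assumes J: "ideal J S" and d: "d \<in> J" "d \<noteq> \<zero>"
    and min: "\<And>x. \<lbrakk>x \<in> J; x \<noteq> \<zero>\<rbrakk> \<Longrightarrow> width d \<le> width x"
    and "x \<in> J"
  shows "\<exists>w. homogeneous w \<and> d divides (w \<otimes> x)"
  using \<open>x \<in> J\<close>
proof (induction "width x" arbitrary: x rule: less_induct)
  case less
  interpret ideal J S by (rule J)
  have dc: "d \<in> carrier S" and xc: "x \<in> carrier S"
    using d less.prems Icarr by auto
  show ?case
  proof (cases "x = \<zero>")
    case True
    then show ?thesis
      using homogeneous_one divides_zero[OF dc] by (intro exI[of _ "\<one>"]) simp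
  next
    case False
    let ?u = "pr (tdeg d) d" and ?v = "pr (tdeg x) x"
    let ?r = "?u \<otimes> x \<ominus> ?v \<otimes> d"
    have c: "?u \<in> carrier S" "?v \<in> carrier S"
      using dc xc by auto
    have rJ: "?r \<in> J"
      unfolding a_minus_def using c d(1) less.prems by (intro a_closed a_inv_closed I_l_closed)
    have "\<exists>w. homogeneous w \<and> d divides (w \<otimes> ?r)"
    proof (cases "?r = \<zero>")
      case True
      then show ?thesis
        using homogeneous_one divides_zero[OF dc] by (intro exI[of _ "\<one>"]) simp
    next
      case r0: False
      then have "width ?r < width x"
        using cross_mult_reduces_width[OF xc False dc d(2) min[OF less.prems False]] by blast
      then show ?thesis
        using less.hyps rJ by blast
    qed
    then obtain w where w: "homogeneous w" "d divides (w \<otimes> ?r)"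
      by blast
    have wc: "w \<in> carrier S"
      using w homogeneous_closed by blast
    have "(w \<otimes> ?u) \<otimes> x = w \<otimes> ?r \<oplus> d \<otimes> (w \<otimes> ?v)"
      using wc c dc xc by algebra
    moreover have "d divides d \<otimes> (w \<otimes> ?v)"
      using wc c by auto
    ultimately have "d divides ((w \<otimes> ?u) \<otimes> x)"
      using divides_add[OF dc _ _ w(2)] wc c dc xc by simp
    moreover have "homogeneous (w \<otimes> ?u)"
      using w wc c homogeneous_mult_iff homogeneous_pr_tdeg[OF dc d(2)] by simp
    ultimately show ?thesis by blast
  qed
qed

text \<open>Two conditions are verified: irreducible elements are prime, and a measure strictly
  decreases along proper divisors.\<close>

theorem graded_factorial:
  fixes len :: "'a \<Rightarrow> nat"
  assumes prime_divisor: "\<And>h. \<lbrakk>homogeneous h; h \<notin> Units S\<rbrakk> \<Longrightarrow> \<exists>p\<in>carrier S. prime S p \<and> p divides h"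
    and len_mult: "\<And>h k. \<lbrakk>homogeneous h; homogeneous k\<rbrakk> \<Longrightarrow> len (h \<otimes> k) = len h + len k"
    and len_unit: "\<And>h. \<lbrakk>homogeneous h; len h = 0\<rbrakk> \<Longrightarrow> h \<in> Units S"
  shows "factorial_domain S"
proof -
  \<comment> \<open>The width ignores homogeneous factors; the length of the top component detects
    them. Together they form an additive measure on nonzero elements whose zeros are units.\<close>
  define M where "M x = width x + len (pr (tdeg x) x)" for x
  have M_mult: "M (x \<otimes> y) = M x + M y"
    if "x \<in> carrier S" "x \<noteq> \<zero>" "y \<in> carrier S" "y \<noteq> \<zero>" for x y
    using that homogeneous_pr_tdeg by (simp add: M_def width_mult tdeg_mult pr_tdeg_mult len_mult)
  have M_unit: "x \<in> Units S" if x: "x \<in> carrier S" "x \<noteq> \<zero>" and M: "M x = 0" for x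
  proof -
    have "width x = 0"
      using M by (simp add: M_def)
    then obtain n where n: "x \<in> H n"
      using width_eq_0_iff[OF x] by blast
    then have "pr (tdeg x) x = x"
      using pr_tdeg[OF x] by (auto simp: pr_homogeneous split: if_splits)
    then show ?thesis
      using M n x len_unit by (auto simp: M_def homogeneous_def)
  qed
  have M_less: "M c < M x"
    if "p \<in> carrier S" "c \<in> carrier S" "x = p \<otimes> c" "p \<notin> Units S" "x \<noteq> \<zero>" for p c x
    using that M_mult[of p c] M_unit[of p] by (cases "p = \<zero>"; cases "c = \<zero>") auto
  define hprime where "hprime p \<longleftrightarrow> homogeneous p \<and> prime S p" for p
  have hprimeD: "p \<in> carrier S" "p \<noteq> \<zero>" "p \<notin> Units S" "homogeneous p" if "hprime p" for p
    using that homogeneous_closed homogeneous_neq_zero by (auto simp: hprime_def prime_def)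
  \<comment> \<open>A prime divisor of \<open>h\<close> is itself homogeneous, being a factor of a
    homogeneous element.\<close>
  have hprime_divisor: "\<exists>p. hprime p \<and> p divides h" if h: "homogeneous h" "h \<notin> Units S" for h
  proof -
    obtain p c where "p \<in> carrier S" "prime S p" "c \<in> carrier S" "h = p \<otimes> c"
      using prime_divisor[OF h] by (auto simp: factor_def)
    then show ?thesis
      using h homogeneous_mult_iff by (auto simp: hprime_def)
  qed
  \<comment> \<open>The analogue of a primitive polynomial, with homogeneous elements in the role of
    contents: \<open>cancel\<close> plays the part of Gauss's lemma, and \<open>decompose\<close>
    extracts the content.\<close>
  define primitive where "primitive g \<longleftrightarrow> (\<forall>p. hprime p \<longrightarrow> \<not> p divides g)" for g
  have cancel: "g divides x"
    if g: "g \<in> carrier S" "primitive g" and x: "x \<in> carrier S"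
      and "homogeneous w" "g divides (w \<otimes> x)" for g w x
    using that(4,5)
  proof (induction "M w" arbitrary: w rule: less_induct)
    case less
    have wc: "w \<in> carrier S" "w \<noteq> \<zero>"
      using less.prems homogeneous_closed homogeneous_neq_zero by auto
    show ?case
    proof (cases "w \<in> Units S")
      case True
      have "x = inv w \<otimes> (w \<otimes> x)"
        using True x wc by (simp add: m_assoc[symmetric])
      then show ?thesis
        using divides_prod_l[OF g(1) _ Units_inv_closed[OF True] less.prems(2)] wc x by simp
    next
      case False
      then obtain p where p: "hprime p" "p divides w"
        using hprime_divisor less.prems by blast
      then obtain w' where w': "w' \<in> carrier S" "w = p \<otimes> w'"
        by (auto simp: factor_def)
      obtain y where y: "y \<in> carrier S" "w \<otimes> x = g \<otimes> y"
        using less.prems by (auto simp: factor_def)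
      have pc: "p \<in> carrier S" "p \<noteq> \<zero>"
        using hprimeD p by auto
      have eq: "g \<otimes> y = p \<otimes> (w' \<otimes> x)"
        using y(2) w' pc x by (simp add: m_assoc)
      then have "p divides (g \<otimes> y)"
        using w' x by auto
      \<comment> \<open>A homogeneous prime cannot divide the primitive \<open>g\<close>, so it
        divides the cofactor \<open>y\<close> and can be cancelled on both sides.\<close>
      then have "p divides y"
        using p g y(1) unfolding primitive_def hprime_def prime_def by blast
      then obtain y' where y': "y' \<in> carrier S" "y = p \<otimes> y'"
        by (auto simp: factor_def)
      have "p \<otimes> (w' \<otimes> x) = p \<otimes> (g \<otimes> y')"
        using eq y' pc g by (simp add: m_lcomm)
      then have "w' \<otimes> x = g \<otimes> y'"
        using m_lcancel[OF pc(2,1)] w' x g y' by simp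
      then have "g divides (w' \<otimes> x)"
        using y' by auto
      moreover have "homogeneous w'"
        using less.prems w' pc homogeneous_mult_iff by simp
      moreover have "M w' < M w"
        using M_less[OF pc(1) w'(1,2)] hprimeD p wc by simp
      ultimately show ?thesis
        using less.hyps by blast
    qed
  qed
  have decompose: "\<exists>w e. homogeneous w \<and> e \<in> carrier S \<and> primitive e \<and> d = w \<otimes> e"
    if "d \<in> carrier S" "d \<noteq> \<zero>" for d
    using that
  proof (induction "M d" arbitrary: d rule: less_induct)
    case less
    show ?case
    proof (cases "primitive d")
      case True
      then show ?thesis
        using homogeneous_one less.prems by (intro exI[of _ "\<one>"] exI[of _ d]) simp
    next
      case False
      then obtain p c where p: "hprime p" and c: "c \<in> carrier S" "d = p \<otimes> c"
        by (auto simp: primitive_def factor_def)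
      note pD = hprimeD[OF p]
      have "c \<noteq> \<zero>"
        using c less.prems pD by auto
      moreover have "M c < M d"
        using M_less[OF pD(1) c] pD less.prems by simp
      ultimately obtain w e where we: "homogeneous w" "e \<in> carrier S" "primitive e" "c = w \<otimes> e"
        using less.hyps c by blast
      have "homogeneous (p \<otimes> w)"
        using pD we homogeneous_closed homogeneous_mult_iff by simp
      moreover have "d = (p \<otimes> w) \<otimes> e"
        using c we pD homogeneous_closed by (simp add: m_assoc)
      ultimately show ?thesis
        using we by blast
    qed
  qed
  have irreducible_prime: "prime S g" if g: "g \<in> carrier S" "ring_irreducible g" for g
  proof (cases "primitive g")
    case False
    then obtain p c where p: "hprime p" and c: "c \<in> carrier S" "g = p \<otimes> c"
      by (auto simp: primitive_def factor_def)
    note pD = hprimeD[OF p]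
    \<comment> \<open>An irreducible element divisible by a homogeneous prime is associated to it,
      and primality is invariant under association.\<close>
    have "c \<in> Units S"
      using ring_irreducibleE(5)[OF g pD(1) c] pD by blast
    then have "p \<sim> g"
      using c pD g by (intro associated_sym[OF associatedI2']) auto
    moreover have "prime S p"
      using p by (simp add: hprime_def)
    ultimately show ?thesis
      using mult_of.prime_cong[of p g] assoc_iff_assoc_mult[of p g] prime_eq_prime_mult pD g
        ring_irreducibleE(1)[OF g] by simp
  next
    case prim: True
    note gE = ring_irreducibleE[OF g]
    show ?thesis
    proof (rule primeI)
      show "g \<notin> Units S" by (rule gE(4))
      fix a b assume a: "a \<in> carrier S" and b: "b \<in> carrier S" and ab: "g divides a \<otimes> b"
      show "g divides a \<or> g divides b"
      proof (rule disjCI, rule ccontr)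
        assume nb: "\<not> g divides b" and na: "\<not> g divides a"
        \<comment> \<open>A Bezout argument in the ideal generated by \<open>g\<close> and
          \<open>a\<close>; a generator up to homogeneous factors replaces the greatest common
          divisor.\<close>
        let ?J = "PIdl g <+>\<^bsub>S\<^esub> PIdl a"
        have J: "ideal ?J S"
          using g a by (intro add_ideals cgenideal_ideal)
        interpret J: ideal ?J S by (rule J)
        have mem: "x \<in> ?J \<longleftrightarrow> (\<exists>y\<in>carrier S. \<exists>z\<in>carrier S. x = y \<otimes> g \<oplus> z \<otimes> a)" for x
          unfolding set_add_def' cgenideal_def by blast
        have gJ: "g \<in> ?J"
          unfolding mem using g a by (intro bexI[of _ "\<one>"] bexI[of _ "\<zero>"]) simp_all
        have aJ: "a \<in> ?J"
          unfolding mem using g a by (intro bexI[of _ "\<zero>"] bexI[of _ "\<one>"]) simp_all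
        \<comment> \<open>An element of least width exists because \<open>g\<close> is a nonzero
          member of the ideal.\<close>
        define d where "d = arg_min width (\<lambda>x. x \<in> ?J \<and> x \<noteq> \<zero>)"
        have d: "d \<in> ?J" "d \<noteq> \<zero>" and min: "\<And>x. \<lbrakk>x \<in> ?J; x \<noteq> \<zero>\<rbrakk> \<Longrightarrow> width d \<le> width x"
          using arg_min_nat_lemma[of "\<lambda>x. x \<in> ?J \<and> x \<noteq> \<zero>" g width] gJ gE(1) unfolding d_def by auto
        obtain w e where we: "homogeneous w" "e \<in> carrier S" "primitive e" "d = w \<otimes> e"
          using decompose J.Icarr d by blast
        have wc: "w \<in> carrier S"
          using we homogeneous_closed by blast
        \<comment> \<open>\<open>e\<close> divides \<open>d\<close>, and \<open>d\<close> divides a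
          homogeneous multiple of \<open>x\<close>; as \<open>e\<close> is primitive, the
          homogeneous factor cancels. So \<open>e\<close> is a common divisor of \<open>g\<close>
          and \<open>a\<close>.\<close>
        have e_dvd: "e divides x" if x: "x \<in> ?J" for x
        proof -
          obtain w' where w': "homogeneous w'" "d divides (w' \<otimes> x)"
            using min_width_divides[OF J d min x] by blast
          have "e divides d"
            using we wc by (metis dividesI' m_comm)
          then have "e divides (w' \<otimes> x)"
            using w' we(2) divides_trans by blast
          then show ?thesis
            using cancel[OF we(2,3) J.Icarr[OF x] w'(1)] by blast
        qed
        obtain c where c: "c \<in> carrier S" "g = e \<otimes> c"
          using e_dvd[OF gJ] by (auto simp: factor_def)
        \<comment> \<open>If \<open>c\<close> were a unit, \<open>g\<close> would divide
          \<open>e\<close> and hence \<open>a\<close>. Irreducibility of \<open>g\<close> therefore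
          makes \<open>e\<close> a unit.\<close>
        have "c \<notin> Units S"
        proof
          assume u: "c \<in> Units S"
          then have "e = g \<otimes> inv c"
            using c we by (simp add: m_assoc)
          then have "g divides e"
            using u by auto
          then show False
            using na e_dvd[OF aJ] divides_trans g by blast
        qed
        then have eU: "e \<in> Units S"
          using gE(5)[OF we(2) c] by blast
        obtain y z where yz: "y \<in> carrier S" "z \<in> carrier S" "d = y \<otimes> g \<oplus> z \<otimes> a"
          using d(1) unfolding mem by blast
        \<comment> \<open>The Bezout relation for \<open>d\<close>, multiplied by \<open>b\<close>.
          Afterwards both factors of \<open>d = w \<otimes> e\<close> are removed: \<open>w\<close>
          because \<open>g\<close> is primitive, \<open>e\<close> because it is a unit.\<close>
        have "g divides (d \<otimes> b)"
        proof -
          have "d \<otimes> b = g \<otimes> (y \<otimes> b) \<oplus> z \<otimes> (a \<otimes> b)"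
            unfolding yz(3) using yz(1,2) a b g by algebra
          moreover have "g divides (z \<otimes> (a \<otimes> b))"
            using divides_prod_l[OF g(1) _ yz(2) ab] a b by simp
          ultimately show ?thesis
            using divides_add[OF g(1)] g(1) a b yz by (simp add: dividesI')
        qed
        then have "g divides (w \<otimes> (e \<otimes> b))"
          using we wc b by (simp add: m_assoc)
        then have "g divides (e \<otimes> b)"
          using cancel[OF g(1) prim _ we(1)] we b by simp
        then have "g divides (inv e \<otimes> (e \<otimes> b))"
          using divides_prod_l[OF g(1) _ Units_inv_closed[OF eU]] we b by simp
        then show False
          using nb eU b we by (simp add: m_assoc[symmetric])
      qed
    qed
  qed
  have "primeness_condition_monoid (mult_of S)"
  proof unfold_locales
    fix a assume a: "a \<in> carrier (mult_of S)" "irreducible (mult_of S) a"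
    then have "ring_irreducible a"
      using ring_irreducibleI' by auto
    then show "prime (mult_of S) a"
      using irreducible_prime prime_eq_prime_mult a by auto
  qed
  moreover have "divisor_chain_condition_monoid (mult_of S)"
  proof unfold_locales
    \<comment> \<open>A proper divisor has a non-unit cofactor, and such a cofactor has positive
      measure.\<close>
    have "M x < M y" if x: "x \<in> carrier (mult_of S)" and y: "y \<in> carrier (mult_of S)"
      and pf: "properfactor (mult_of S) x y" for x y
    proof -
      obtain c where c: "c \<in> carrier S" "c \<noteq> \<zero>" "y = x \<otimes> c"
        using pf by (auto simp: properfactor_def factor_def)
      have "c \<notin> Units S"
      proof
        assume u: "c \<in> Units S"
        then have "x = y \<otimes> inv c"
          using c x by (simp add: m_assoc)
        then have "y divides\<^bsub>S\<^esub> x"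
          using u by auto
        then show False
          using pf x y by (auto simp: properfactor_def)
      qed
      then show ?thesis
        using M_less[of c x y] c x y by (simp add: m_comm)
    qed
    then have "{(x, y). x \<in> carrier (mult_of S) \<and> y \<in> carrier (mult_of S) \<and> properfactor (mult_of S) x y}
        \<subseteq> Wellfounded.measure M"
      by auto
    then show "wf {(x, y). x \<in> carrier (mult_of S) \<and> y \<in> carrier (mult_of S) \<and> properfactor (mult_of S) x y}"
      using wf_subset wf_measure by blast
  qed
  ultimately have "factorial_monoid (mult_of S)"
    using factorial_condition_one by blast
  then show ?thesis
    by (intro factorial_domain.intro domain_axioms)
qed

end

subsection \<open>Factorial monoids and primes\<close>

lemma (in factorial_monoid) factorcount_mult:
  assumes "a \<in> carrier G" "b \<in> carrier G"
  shows "factorcount G (a \<otimes> b) = factorcount G a + factorcount G b"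
proof -
  obtain as where as: "set as \<subseteq> carrier G" "wfactors G as a"
    using wfactors_exist assms by blast
  obtain bs where bs: "set bs \<subseteq> carrier G" "wfactors G bs b"
    using wfactors_exist assms by blast
  have "wfactors G (as @ bs) (a \<otimes> b)"
    using as bs assms by (intro wfactors_mult)
  then show ?thesis
    using as bs assms factorcount_unique[of as a] factorcount_unique[of bs b]
      factorcount_unique[of "as @ bs" "a \<otimes> b"] by simp
qed

lemma (in factorial_monoid) factorcount_eq_0:
  assumes "a \<in> carrier G" "factorcount G a = 0"
  shows "a \<in> Units G"
proof -
  obtain as where as: "set as \<subseteq> carrier G" "wfactors G as a"
    using wfactors_exist assms by blast
  then have "as = []"
    using factorcount_unique[of as a] assms by simp
  then show ?thesis
    using as assms by (metis Units_one_closed assoc_unit_r foldr.simps(1) id_apply wfactors_def)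
qed

lemma (in factorial_monoid) factorcount_irreducible:
  assumes "p \<in> carrier G" "irreducible G p"
  shows "factorcount G p = 1"
proof -
  have "wfactors G [p] p"
    using assms by (simp add: wfactors_def)
  then show ?thesis
    using factorcount_unique[of "[p]" p] assms by simp
qed

lemma (in factorial_monoid) factorcount_pow:
  assumes "a \<in> carrier G"
  shows "factorcount G (a [^] (n::nat)) = n * factorcount G a"
proof (induction n)
  case 0
  have "wfactors G [] \<one>"
    by (simp add: wfactors_def)
  then show ?case
    using factorcount_unique[of "[]" "\<one>"] by simp
qed (simp add: factorcount_mult assms)

lemma (in factorial_domain) prime_divisor_exists:
  assumes "a \<in> carrier R" "a \<noteq> \<zero>" "a \<notin> Units R"
  shows "\<exists>p. p \<in> carrier R \<and> p \<noteq> \<zero> \<and> prime R p \<and> p divides a"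
proof -
  obtain fs where fs: "set fs \<subseteq> carrier (mult_of R)" "factors (mult_of R) fs a"
    using factors_exist[of a] assms by auto
  then have "fs \<noteq> []"
    using assms by (auto simp: factors_def)
  then obtain p ps where p: "fs = p # ps"
    by (cases fs) auto
  have pc: "p \<in> carrier R" "p \<noteq> \<zero>"
    using fs p by auto
  have "irreducible (mult_of R) p"
    using fs p by (simp add: factors_def)
  then have "prime R p"
    using irreducible_prime[of p] prime_eq_prime_mult[of p] pc by simp
  moreover have "p divides a"
    using mult_of.factors_dividesI[OF fs(2) _ fs(1), of p] p by simp
  ultimately show ?thesis
    using pc by blast
qed

lemma (in domain) prime_imp_ring_irreducible:
  assumes "p \<in> carrier R" "p \<noteq> \<zero>" "prime R p"
  shows "ring_irreducible p"
proof (rule ring_irreducibleI')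
  show "irreducible (mult_of R) p"
    using assms(3) prime_eq_prime_mult[OF assms(1)] mult_of.prime_irreducible by blast
qed (use assms(1,2) in blast)

lemma prime_dividesD:
  fixes G (structure)
  assumes "prime G p" "a \<in> carrier G" "b \<in> carrier G" "p divides a \<otimes> b"
  shows "p divides a \<or> p divides b"
  using assms unfolding prime_def by blast

lemma (in domain) prime_divides_pow:
  assumes p: "p \<in> carrier R" "prime R p" and a: "a \<in> carrier R" "p divides a [^] (n::nat)"
  shows "p divides a"
  using a(2)
proof (induction n)
  case 0
  then show ?case
    using p divides_one[OF p(1)] unfolding prime_def by simp
next
  case (Suc n)
  then have "p divides a [^] n \<or> p divides a"
    using p(2) a(1) unfolding prime_def by simp
  then show ?case
    using Suc.IH by blast
qed

subsection \<open>Adjoining two elements with product f\<close>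

text \<open>\<open>T n\<close> reads off the coefficient in degree \<open>n\<close>. Its existence
  encodes that \<open>uv = f\<close> is the only relation: it makes \<open>\<iota>\<close> injective
  and each homogeneous component free of rank one. The exponent \<open>min i j\<close> counts the
  pairs \<open>uv\<close> in the monomial.\<close>

locale uv_extension = R: domain R + h: ring_hom_cring R S \<iota>
  for R (structure) and S (structure) and \<iota> +
  fixes f and u and v and T :: "int \<Rightarrow> 'c \<Rightarrow> 'a"
  assumes f_closed [simp]: "f \<in> carrier R" and f_neq_zero: "f \<noteq> \<zero>"
    and u_closed [simp]: "u \<in> carrier S" and v_closed [simp]: "v \<in> carrier S"
    and uv: "u \<otimes>\<^bsub>S\<^esub> v = \<iota> f"
    and T_closed [simp]: "x \<in> carrier S \<Longrightarrow> T n x \<in> carrier R"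
    and T_add: "\<lbrakk>x \<in> carrier S; y \<in> carrier S\<rbrakk> \<Longrightarrow> T n (x \<oplus>\<^bsub>S\<^esub> y) = T n x \<oplus> T n y"
    and T_monom: "a \<in> carrier R \<Longrightarrow> T n (\<iota> a \<otimes>\<^bsub>S\<^esub> (u [^]\<^bsub>S\<^esub> i \<otimes>\<^bsub>S\<^esub> v [^]\<^bsub>S\<^esub> j)) =
      (if n = int i - int j then a \<otimes> f [^] min i j else \<zero>)"
    and monom_generate: "\<lbrakk>x \<in> carrier S;
      \<And>a i j. a \<in> carrier R \<Longrightarrow> \<iota> a \<otimes>\<^bsub>S\<^esub> (u [^]\<^bsub>S\<^esub> (i::nat) \<otimes>\<^bsub>S\<^esub> v [^]\<^bsub>S\<^esub> (j::nat)) \<in> Q;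
      \<And>y z. \<lbrakk>y \<in> Q; z \<in> Q\<rbrakk> \<Longrightarrow> y \<oplus>\<^bsub>S\<^esub> z \<in> Q\<rbrakk> \<Longrightarrow> x \<in> Q"
begin

declare h.hom_mult [simp del]

text \<open>Exchanging \<open>u\<close> and \<open>v\<close> reverses the degrees; each result on
  \<open>u\<close> thereby yields one on \<open>v\<close>.\<close>

lemma swap: "uv_extension R S \<iota> f v u (\<lambda>n. T (- n))"
proof unfold_locales
  show "v \<otimes>\<^bsub>S\<^esub> u = \<iota> f"
    using uv h.S.m_comm by simp
  show "T (- n) (\<iota> a \<otimes>\<^bsub>S\<^esub> (v [^]\<^bsub>S\<^esub> i \<otimes>\<^bsub>S\<^esub> u [^]\<^bsub>S\<^esub> j)) =
      (if n = int i - int j then a \<otimes> f [^] min i j else \<zero>)" if "a \<in> carrier R" for a n i j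
    using T_monom[OF that, of "- n" j i] by (auto simp: h.S.m_comm min.commute)
  show "x \<in> Q" if "x \<in> carrier S"
      "\<And>a i j. a \<in> carrier R \<Longrightarrow> \<iota> a \<otimes>\<^bsub>S\<^esub> (v [^]\<^bsub>S\<^esub> (i::nat) \<otimes>\<^bsub>S\<^esub> u [^]\<^bsub>S\<^esub> (j::nat)) \<in> Q"
      "\<And>y z. \<lbrakk>y \<in> Q; z \<in> Q\<rbrakk> \<Longrightarrow> y \<oplus>\<^bsub>S\<^esub> z \<in> Q" for x Q
  proof (rule monom_generate[OF that(1) _ that(3)])
    show "\<iota> a \<otimes>\<^bsub>S\<^esub> (u [^]\<^bsub>S\<^esub> (i::nat) \<otimes>\<^bsub>S\<^esub> v [^]\<^bsub>S\<^esub> (j::nat)) \<in> Q" if a: "a \<in> carrier R" for a i j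
      using \<open>\<And>a i j. a \<in> carrier R \<Longrightarrow> \<iota> a \<otimes>\<^bsub>S\<^esub> (v [^]\<^bsub>S\<^esub> (i::nat) \<otimes>\<^bsub>S\<^esub> u [^]\<^bsub>S\<^esub> (j::nat)) \<in> Q\<close>[OF a, of j i]
      by (simp add: h.S.m_comm)
  qed
qed (simp_all add: f_neq_zero T_add)

section \<open>The homogeneous generators and their products\<close>

definition e :: "int \<Rightarrow> 'c" where
  "e n = u [^]\<^bsub>S\<^esub> nat n \<otimes>\<^bsub>S\<^esub> v [^]\<^bsub>S\<^esub> nat (- n)"

text \<open>The number of pairs $uv$ that cancel in the product of $e_n$ and $e_m$.\<close>
definition overlap :: "int \<Rightarrow> int \<Rightarrow> nat" where
  "overlap n m = min (nat n + nat m) (nat (- n) + nat (- m))"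

lemma e_closed [simp]: "e n \<in> carrier S"
  by (simp add: e_def)

lemma e_0 [simp]: "e 0 = \<one>\<^bsub>S\<^esub>"
  by (simp add: e_def)

lemma e_1: "e 1 = u"
  by (simp add: e_def)

lemma iota_pow: "a \<in> carrier R \<Longrightarrow> \<iota> (a [^] (n::nat)) = \<iota> a [^]\<^bsub>S\<^esub> n"
  by (induction n) (auto simp: h.hom_mult)

lemma f_pow_neq_zero: "f [^] (k::nat) \<noteq> \<zero>"
  by (induction k) (auto simp: R.integral_iff f_neq_zero)

lemma iota_Units:
  assumes "a \<in> Units R"
  shows "\<iota> a \<in> Units S"
proof -
  have "\<iota> a \<otimes>\<^bsub>S\<^esub> \<iota> (inv a) = \<one>\<^bsub>S\<^esub>"
    using assms h.hom_mult[of a "inv a"] R.Units_closed[OF assms] by simp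
  then show ?thesis
    using assms R.Units_closed[OF assms] h.S.unit_factor[of "\<iota> a" "\<iota> (inv a)"] by simp
qed

lemma T_e: "a \<in> carrier R \<Longrightarrow> T m (\<iota> a \<otimes>\<^bsub>S\<^esub> e n) = (if m = n then a else \<zero>)"
  using T_monom[of a m "nat n" "nat (- n)"] by (cases "n \<ge> 0") (auto simp: e_def)

lemma monom_eq_e: "u [^]\<^bsub>S\<^esub> i \<otimes>\<^bsub>S\<^esub> v [^]\<^bsub>S\<^esub> j = \<iota> (f [^] min i j) \<otimes>\<^bsub>S\<^esub> e (int i - int j)"
proof -
  have uvk: "u [^]\<^bsub>S\<^esub> k \<otimes>\<^bsub>S\<^esub> v [^]\<^bsub>S\<^esub> k = \<iota> (f [^] k)" for k :: nat
    by (simp add: iota_pow flip: uv h.S.nat_pow_distrib)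
  show ?thesis
  proof (cases "i \<le> j")
    case True
    have "v [^]\<^bsub>S\<^esub> j = v [^]\<^bsub>S\<^esub> i \<otimes>\<^bsub>S\<^esub> v [^]\<^bsub>S\<^esub> (j - i)"
      using True by (simp add: h.S.nat_pow_mult)
    then show ?thesis
      using True uvk[of i] by (simp add: e_def min_def nat_diff_distrib h.S.m_assoc[symmetric])
  next
    case False
    have "u [^]\<^bsub>S\<^esub> i = u [^]\<^bsub>S\<^esub> (i - j) \<otimes>\<^bsub>S\<^esub> u [^]\<^bsub>S\<^esub> j"
      using False by (simp add: h.S.nat_pow_mult)
    then have "u [^]\<^bsub>S\<^esub> i \<otimes>\<^bsub>S\<^esub> v [^]\<^bsub>S\<^esub> j = (u [^]\<^bsub>S\<^esub> j \<otimes>\<^bsub>S\<^esub> v [^]\<^bsub>S\<^esub> j) \<otimes>\<^bsub>S\<^esub> u [^]\<^bsub>S\<^esub> (i - j)"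
      by (simp add: h.S.m_ac)
    then show ?thesis
      using False uvk[of j] by (simp add: e_def min_def nat_diff_distrib)
  qed
qed

lemma e_mult: "e n \<otimes>\<^bsub>S\<^esub> e m = \<iota> (f [^] overlap n m) \<otimes>\<^bsub>S\<^esub> e (n + m)"
proof -
  have "e n \<otimes>\<^bsub>S\<^esub> e m = (u [^]\<^bsub>S\<^esub> nat n \<otimes>\<^bsub>S\<^esub> u [^]\<^bsub>S\<^esub> nat m) \<otimes>\<^bsub>S\<^esub> (v [^]\<^bsub>S\<^esub> nat (- n) \<otimes>\<^bsub>S\<^esub> v [^]\<^bsub>S\<^esub> nat (- m))"
    unfolding e_def by (simp add: h.S.m_ac)
  also have "\<dots> = u [^]\<^bsub>S\<^esub> (nat n + nat m) \<otimes>\<^bsub>S\<^esub> v [^]\<^bsub>S\<^esub> (nat (- n) + nat (- m))"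
    by (simp add: h.S.nat_pow_mult)
  also have "\<dots> = \<iota> (f [^] overlap n m) \<otimes>\<^bsub>S\<^esub> e (int (nat n + nat m) - int (nat (- n) + nat (- m)))"
    unfolding monom_eq_e overlap_def ..
  also have "int (nat n + nat m) - int (nat (- n) + nat (- m)) = n + m"
    by linarith
  finally show ?thesis .
qed

lemma homog_mult:
  assumes "a \<in> carrier R" "b \<in> carrier R"
  shows "(\<iota> a \<otimes>\<^bsub>S\<^esub> e n) \<otimes>\<^bsub>S\<^esub> (\<iota> b \<otimes>\<^bsub>S\<^esub> e m) = \<iota> (a \<otimes> b \<otimes> f [^] overlap n m) \<otimes>\<^bsub>S\<^esub> e (n + m)"
proof -
  have "(\<iota> a \<otimes>\<^bsub>S\<^esub> e n) \<otimes>\<^bsub>S\<^esub> (\<iota> b \<otimes>\<^bsub>S\<^esub> e m) = (\<iota> a \<otimes>\<^bsub>S\<^esub> \<iota> b) \<otimes>\<^bsub>S\<^esub> (e n \<otimes>\<^bsub>S\<^esub> e m)"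
    using assms by (simp add: h.S.m_ac)
  then show ?thesis
    using assms by (simp add: e_mult h.S.m_assoc h.hom_mult)
qed

lemma homog_eq_iff:
  assumes "a \<in> carrier R" "b \<in> carrier R" "a \<noteq> \<zero>"
  shows "\<iota> a \<otimes>\<^bsub>S\<^esub> e n = \<iota> b \<otimes>\<^bsub>S\<^esub> e m \<longleftrightarrow> n = m \<and> a = b"
proof
  assume "\<iota> a \<otimes>\<^bsub>S\<^esub> e n = \<iota> b \<otimes>\<^bsub>S\<^esub> e m"
  then have "a = (if n = m then b else \<zero>)"
    using T_e[OF assms(1), of n n] T_e[OF assms(2), of n m] by argo
  then show "n = m \<and> a = b"
    using assms(3) by presburger
qed simp

lemma T_zero [simp]: "T n \<zero>\<^bsub>S\<^esub> = \<zero>"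
  using T_e[of \<zero> n 0] by simp

lemma homog_eq_zero_iff: "a \<in> carrier R \<Longrightarrow> \<iota> a \<otimes>\<^bsub>S\<^esub> e n = \<zero>\<^bsub>S\<^esub> \<longleftrightarrow> a = \<zero>"
  using T_e[of a n n] T_zero[of n] by auto

section \<open>The grading of \<open>S\<close>\<close>

definition H :: "int \<Rightarrow> 'c set" where
  "H n = {\<iota> a \<otimes>\<^bsub>S\<^esub> e n | a. a \<in> carrier R}"

definition pr :: "int \<Rightarrow> 'c \<Rightarrow> 'c" where
  "pr n x = \<iota> (T n x) \<otimes>\<^bsub>S\<^esub> e n"

sublocale G: int_graded_cring S H pr
proof unfold_locales
  show "H n \<subseteq> carrier S" for n
    by (auto simp: H_def)
  show "x \<otimes>\<^bsub>S\<^esub> y \<in> H (n + m)" if xy: "x \<in> H n" "y \<in> H m" for x y n m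
  proof -
    obtain a b where "a \<in> carrier R" "b \<in> carrier R" "x = \<iota> a \<otimes>\<^bsub>S\<^esub> e n" "y = \<iota> b \<otimes>\<^bsub>S\<^esub> e m"
      using xy(1,2) unfolding H_def by blast
    then show ?thesis
      using homog_mult[of a b n m] by (auto simp: H_def)
  qed
  show "x = \<zero>\<^bsub>S\<^esub> \<or> y = \<zero>\<^bsub>S\<^esub>" if xy: "x \<in> H n" "y \<in> H m" "x \<otimes>\<^bsub>S\<^esub> y = \<zero>\<^bsub>S\<^esub>" for x y n m
  proof -
    obtain a b where ab: "a \<in> carrier R" "b \<in> carrier R" "x = \<iota> a \<otimes>\<^bsub>S\<^esub> e n" "y = \<iota> b \<otimes>\<^bsub>S\<^esub> e m"
      using xy(1,2) unfolding H_def by blast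
    then have "a \<otimes> b \<otimes> f [^] overlap n m = \<zero>"
      using xy(3) homog_mult[of a b n m] by (simp add: homog_eq_zero_iff)
    moreover have "f [^] overlap n m \<noteq> \<zero>"
      by (rule f_pow_neq_zero)
    ultimately show ?thesis
      using ab by (auto simp: R.integral_iff)
  qed
  show "\<one>\<^bsub>S\<^esub> \<in> H 0"
    unfolding H_def by (intro CollectI exI[of _ \<one>]) simp
  show "\<one>\<^bsub>S\<^esub> \<noteq> \<zero>\<^bsub>S\<^esub>"
    using homog_eq_zero_iff[of \<one> 0] by simp
  show "pr n x \<in> H n" if "x \<in> carrier S" for x n
    using that by (auto simp: pr_def H_def)
  show "pr n (x \<oplus>\<^bsub>S\<^esub> y) = pr n x \<oplus>\<^bsub>S\<^esub> pr n y" if "x \<in> carrier S" "y \<in> carrier S" for x y n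
    using that by (simp add: pr_def T_add h.S.l_distr)
  show "pr m x = (if m = n then x else \<zero>\<^bsub>S\<^esub>)" if "x \<in> H n" for x n m
    using that by (auto simp: pr_def H_def T_e)
  show "x \<in> Q" if x: "x \<in> carrier S" and Q: "\<And>n h. h \<in> H n \<Longrightarrow> h \<in> Q"
    "\<And>y z. \<lbrakk>y \<in> Q; z \<in> Q\<rbrakk> \<Longrightarrow> y \<oplus>\<^bsub>S\<^esub> z \<in> Q" for x Q
  proof (rule monom_generate[OF x _ Q(2)])
    fix a and i j :: nat assume a: "a \<in> carrier R"
    have "\<iota> a \<otimes>\<^bsub>S\<^esub> (u [^]\<^bsub>S\<^esub> i \<otimes>\<^bsub>S\<^esub> v [^]\<^bsub>S\<^esub> j) = \<iota> (a \<otimes> f [^] min i j) \<otimes>\<^bsub>S\<^esub> e (int i - int j)"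
      using a by (simp add: monom_eq_e h.S.m_assoc h.hom_mult)
    then show "\<iota> a \<otimes>\<^bsub>S\<^esub> (u [^]\<^bsub>S\<^esub> i \<otimes>\<^bsub>S\<^esub> v [^]\<^bsub>S\<^esub> j) \<in> Q"
      using a by (intro Q(1)[of _ "int i - int j"]) (auto simp: H_def)
  qed
qed

lemma homogeneousE:
  assumes "G.homogeneous x"
  obtains a n where "a \<in> carrier R" "a \<noteq> \<zero>" "x = \<iota> a \<otimes>\<^bsub>S\<^esub> e n"
  using assms homog_eq_zero_iff by (auto simp: G.homogeneous_def H_def)

lemma homogeneousI: "\<lbrakk>a \<in> carrier R; a \<noteq> \<zero>\<rbrakk> \<Longrightarrow> G.homogeneous (\<iota> a \<otimes>\<^bsub>S\<^esub> e n)"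
  using homog_eq_zero_iff by (auto simp: G.homogeneous_def H_def)

lemma homogeneous_u: "G.homogeneous u"
  using homogeneousI[of \<one> 1] by (simp add: e_1)

lemma homogeneous_iota: "\<lbrakk>a \<in> carrier R; a \<noteq> \<zero>\<rbrakk> \<Longrightarrow> G.homogeneous (\<iota> a)"
  using homogeneousI[of a 0] by simp

text \<open>Factors of a homogeneous element are homogeneous, so a factorization in \<open>S\<close>
  amounts to a splitting of the degree and a factorization of the coefficient in \<open>R\<close>,
  with a power of \<open>f\<close> for the cancelling pairs \<open>uv\<close>.\<close>

lemma homog_factorsE:
  assumes "x \<in> carrier S" "y \<in> carrier S" "a \<in> carrier R" "a \<noteq> \<zero>" "x \<otimes>\<^bsub>S\<^esub> y = \<iota> a \<otimes>\<^bsub>S\<^esub> e k"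
  obtains b c n m where "b \<in> carrier R" "c \<in> carrier R" "x = \<iota> b \<otimes>\<^bsub>S\<^esub> e n" "y = \<iota> c \<otimes>\<^bsub>S\<^esub> e m"
    "n + m = k" "b \<otimes> c \<otimes> f [^] overlap n m = a"
proof -
  have "G.homogeneous x" "G.homogeneous y"
    using G.homogeneous_mult_iff[OF assms(1,2)] homogeneousI[OF assms(3,4), of k] assms(5) by auto
  obtain b n where b: "b \<in> carrier R" "x = \<iota> b \<otimes>\<^bsub>S\<^esub> e n"
    using \<open>G.homogeneous x\<close> by (rule homogeneousE)
  obtain c m where c: "c \<in> carrier R" "y = \<iota> c \<otimes>\<^bsub>S\<^esub> e m"
    using \<open>G.homogeneous y\<close> by (rule homogeneousE)
  note bc = b c
  then have "\<iota> a \<otimes>\<^bsub>S\<^esub> e k = \<iota> (b \<otimes> c \<otimes> f [^] overlap n m) \<otimes>\<^bsub>S\<^esub> e (n + m)"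
    using homog_mult[of b c n m] assms(5) by simp
  then show thesis
    using that[OF bc(1,3,2,4)] bc assms(3,4) homog_eq_iff[of a "b \<otimes> c \<otimes> f [^] overlap n m" k "n + m"]
    by (simp)
qed

section \<open>Divisibility by homogeneous elements\<close>

text \<open>\<open>\<iota> p\<close> has degree 0 and hence acts on each coefficient separately; the
  coefficients in degree \<open>n\<close> are compared. For \<open>n = 0\<close> this says that
  \<open>\<iota>\<close> preserves and reflects divisibility.\<close>

lemma iota_divides_iff:
  assumes "p \<in> carrier R" "a \<in> carrier R"
  shows "\<iota> p divides\<^bsub>S\<^esub> (\<iota> a \<otimes>\<^bsub>S\<^esub> e n) \<longleftrightarrow> p divides a"
proof
  assume "\<iota> p divides\<^bsub>S\<^esub> (\<iota> a \<otimes>\<^bsub>S\<^esub> e n)"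
  then obtain y where y: "y \<in> carrier S" "\<iota> a \<otimes>\<^bsub>S\<^esub> e n = \<iota> p \<otimes>\<^bsub>S\<^esub> y"
    by (auto simp: factor_def)
  have "\<iota> p \<in> H 0"
    using assms by (auto simp: H_def intro: exI[of _ p])
  then have "pr n (\<iota> p \<otimes>\<^bsub>S\<^esub> y) = \<iota> (p \<otimes> T n y) \<otimes>\<^bsub>S\<^esub> e n"
    using G.pr_homogeneous_mult[of "\<iota> p" 0 y n] y(1) assms by (simp add: pr_def h.S.m_assoc h.hom_mult)
  then have "T n (pr n (\<iota> p \<otimes>\<^bsub>S\<^esub> y)) = p \<otimes> T n y"
    using assms y(1) by (simp add: T_e)
  moreover have "T n (pr n (\<iota> a \<otimes>\<^bsub>S\<^esub> e n)) = a"
    using assms by (simp add: pr_def T_e)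
  ultimately have "a = p \<otimes> T n y"
    using y by simp
  then show "p divides a"
    using y by auto
next
  assume "p divides a"
  then obtain c where "c \<in> carrier R" "a = p \<otimes> c"
    by (auto simp: factor_def)
  then have "\<iota> a \<otimes>\<^bsub>S\<^esub> e n = \<iota> p \<otimes>\<^bsub>S\<^esub> (\<iota> c \<otimes>\<^bsub>S\<^esub> e n)"
    using assms by (simp add: h.S.m_assoc h.hom_mult)
  then show "\<iota> p divides\<^bsub>S\<^esub> (\<iota> a \<otimes>\<^bsub>S\<^esub> e n)"
    using \<open>c \<in> carrier R\<close> by auto
qed

text \<open>Multiplication by \<open>u\<close> sends \<open>e (n - 1)\<close> to \<open>e n\<close>
  if \<open>n > 0\<close>, and to \<open>f\<close> times \<open>e n\<close> otherwise, because then
  a \<open>v\<close> is cancelled.\<close>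

lemma u_divides_iff:
  assumes "a \<in> carrier R"
  shows "u divides\<^bsub>S\<^esub> (\<iota> a \<otimes>\<^bsub>S\<^esub> e n) \<longleftrightarrow> n > 0 \<or> f divides a"
proof
  assume "u divides\<^bsub>S\<^esub> (\<iota> a \<otimes>\<^bsub>S\<^esub> e n)"
  then obtain y where y: "y \<in> carrier S" "\<iota> a \<otimes>\<^bsub>S\<^esub> e n = u \<otimes>\<^bsub>S\<^esub> y"
    by (auto simp: factor_def)
  let ?b = "T (n - 1) y \<otimes> f [^] overlap 1 (n - 1)"
  have u: "u = \<iota> \<one> \<otimes>\<^bsub>S\<^esub> e 1"
    by (simp add: e_1)
  then have "u \<in> H 1"
    unfolding H_def by blast
  then have "pr n (u \<otimes>\<^bsub>S\<^esub> y) = u \<otimes>\<^bsub>S\<^esub> (\<iota> (T (n - 1) y) \<otimes>\<^bsub>S\<^esub> e (n - 1))"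
    using G.pr_homogeneous_mult[of u 1 y n] y(1) by (simp add: pr_def)
  also have "\<dots> = \<iota> ?b \<otimes>\<^bsub>S\<^esub> e n"
    using homog_mult[of \<one> "T (n - 1) y" 1 "n - 1"] y(1) u by simp
  finally have "T n (pr n (u \<otimes>\<^bsub>S\<^esub> y)) = ?b"
    using y(1) by (simp add: T_e)
  moreover have "T n (pr n (\<iota> a \<otimes>\<^bsub>S\<^esub> e n)) = a"
    using assms by (simp add: pr_def T_e)
  ultimately have a: "a = ?b"
    using y by simp
  have "overlap 1 (n - 1) = 1" if "\<not> n > 0"
    using that by (simp add: overlap_def)
  then have "f divides a" if "\<not> n > 0"
    using that y(1) a by (simp add: R.m_comm dividesI')
  then show "n > 0 \<or> f divides a"
    by blast
next
  assume "n > 0 \<or> f divides a"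
  then consider "n > 0" | c where "c \<in> carrier R" "a = f \<otimes> c"
    by (auto simp: factor_def)
  then show "u divides\<^bsub>S\<^esub> (\<iota> a \<otimes>\<^bsub>S\<^esub> e n)"
  proof cases
    case 1
    then have "overlap 1 (n - 1) = 0"
      by (simp add: overlap_def)
    then have "e n = u \<otimes>\<^bsub>S\<^esub> e (n - 1)"
      using e_mult[of 1 "n - 1"] by (simp add: e_1)
    then have "\<iota> a \<otimes>\<^bsub>S\<^esub> e n = u \<otimes>\<^bsub>S\<^esub> (\<iota> a \<otimes>\<^bsub>S\<^esub> e (n - 1))"
      using assms by (simp add: h.S.m_lcomm)
    then show ?thesis
      using assms by auto
  next
    case 2
    then have "\<iota> a \<otimes>\<^bsub>S\<^esub> e n = u \<otimes>\<^bsub>S\<^esub> (v \<otimes>\<^bsub>S\<^esub> (\<iota> c \<otimes>\<^bsub>S\<^esub> e n))"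
      by (simp add: h.S.m_assoc h.hom_mult flip: uv)
    then show ?thesis
      using 2 by auto
  qed
qed

section \<open>Primes of \<open>S\<close>\<close>

text \<open>For two factors of degree at most 0 no pairs \<open>uv\<close> cancel, so by
  \<open>u_divides_iff\<close> primality of \<open>f\<close> applies to the coefficients; a factor
  of positive degree is divisible by \<open>u\<close> anyway.\<close>

lemma prime_u:
  assumes f: "prime R f"
  shows "prime S u"
proof (rule G.graded_prime_imp_prime)
  have "u \<notin> Units S"
  proof
    assume "u \<in> Units S"
    then have "u divides\<^bsub>S\<^esub> (\<iota> \<one> \<otimes>\<^bsub>S\<^esub> e 0)"
      by (simp add: h.S.unit_divides)
    then show False
      using u_divides_iff[of \<one> 0] R.divides_one[OF f_closed] f unfolding prime_def by blast
  qed
  moreover have "u divides\<^bsub>S\<^esub> x \<or> u divides\<^bsub>S\<^esub> y"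
    if "G.homogeneous x" "G.homogeneous y" and xy: "u divides\<^bsub>S\<^esub> (x \<otimes>\<^bsub>S\<^esub> y)" for x y
  proof -
    obtain a n where a: "a \<in> carrier R" "x = \<iota> a \<otimes>\<^bsub>S\<^esub> e n"
      using \<open>G.homogeneous x\<close> by (rule homogeneousE)
    obtain b m where b: "b \<in> carrier R" "y = \<iota> b \<otimes>\<^bsub>S\<^esub> e m"
      using \<open>G.homogeneous y\<close> by (rule homogeneousE)
    have "n + m > 0 \<or> f divides (a \<otimes> b \<otimes> f [^] overlap n m)"
      using xy a b u_divides_iff by (simp add: homog_mult)
    then have "n > 0 \<or> m > 0 \<or> f divides (a \<otimes> b)"
    proof (elim disjE)
      assume *: "f divides (a \<otimes> b \<otimes> f [^] overlap n m)"
      show ?thesis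
      proof (cases "overlap n m = 0")
        case True
        then show ?thesis
          using * a b by simp
      next
        \<comment> \<open>A cancelling pair needs degrees of opposite signs, so one of them is
          positive.\<close>
        case False
        then show ?thesis
          by (auto simp: overlap_def)
      qed
    qed auto
    then have "n > 0 \<or> m > 0 \<or> f divides a \<or> f divides b"
      using f a b unfolding prime_def by blast
    then show ?thesis
      using a b u_divides_iff by blast
  qed
  ultimately show "G.graded_prime u"
    using homogeneous_u by (simp add: G.graded_prime_def)
qed

text \<open>The coefficient of a product of homogeneous elements carries an extra power of
  \<open>f\<close>, and the prime \<open>p\<close> divides no power of \<open>f\<close>.\<close>

lemma prime_iota:
  assumes p: "p \<in> carrier R" "p \<noteq> \<zero>" "prime R p" and pf: "\<not> p divides f"
  shows "prime S (\<iota> p)"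
proof (rule G.graded_prime_imp_prime)
  have "\<iota> p \<notin> Units S"
  proof
    assume "\<iota> p \<in> Units S"
    then have "\<iota> p divides\<^bsub>S\<^esub> (\<iota> \<one> \<otimes>\<^bsub>S\<^esub> e 0)"
      by (simp add: h.S.unit_divides)
    then show False
      using iota_divides_iff[of p \<one> 0] R.divides_one[OF p(1)] p unfolding prime_def by blast
  qed
  moreover have "\<iota> p divides\<^bsub>S\<^esub> x \<or> \<iota> p divides\<^bsub>S\<^esub> y"
    if "G.homogeneous x" "G.homogeneous y" and xy: "\<iota> p divides\<^bsub>S\<^esub> (x \<otimes>\<^bsub>S\<^esub> y)" for x y
  proof -
    obtain a n where a: "a \<in> carrier R" "x = \<iota> a \<otimes>\<^bsub>S\<^esub> e n"
      using \<open>G.homogeneous x\<close> by (rule homogeneousE)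
    obtain b m where b: "b \<in> carrier R" "y = \<iota> b \<otimes>\<^bsub>S\<^esub> e m"
      using \<open>G.homogeneous y\<close> by (rule homogeneousE)
    have "p divides (a \<otimes> b \<otimes> f [^] overlap n m)"
      using xy a b p(1) iota_divides_iff by (simp add: homog_mult)
    then have "p divides (a \<otimes> b) \<or> p divides f [^] overlap n m"
      using prime_dividesD[OF p(3)] a b by simp
    moreover have "\<not> p divides f [^] overlap n m"
      using R.prime_divides_pow[OF p(1,3) f_closed] pf by blast
    ultimately have "p divides a \<or> p divides b"
      using p(3) a b unfolding prime_def by blast
    then show ?thesis
      using a b p iota_divides_iff by blast
  qed
  ultimately show "G.graded_prime (\<iota> p)"
    using homogeneous_iota p by (simp add: G.graded_prime_def)
qed

section \<open>Factoriality passes from \<open>R\<close> to \<open>S\<close>\<close>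

lemma factorial_if:
  assumes "factorial_domain R" and f: "prime R f"
  shows "factorial_domain S"
proof -
  interpret F: factorial_domain R by (rule assms)
  \<comment> \<open>Primality of \<open>v\<close> is primality of \<open>u\<close> in the exchanged
    extension, where degrees change sign.\<close>
  interpret sw: uv_extension R S \<iota> f v u "\<lambda>n. T (- n)" by (rule swap)
  have sw_e: "sw.e n = e (- n)" for n
    by (simp add: e_def sw.e_def h.S.m_comm)
  define \<Omega> where "\<Omega> = factorcount (mult_of R)"
  \<comment> \<open>the weights $2$ and $1$ make the length additive in spite of $uv = f$\<close>
  define len where "len x = (2 * \<Omega> (T (G.tdeg x) x) + nat \<bar>G.tdeg x\<bar>)" for x
  have len: "len (\<iota> a \<otimes>\<^bsub>S\<^esub> e n) = 2 * \<Omega> a + nat \<bar>n\<bar>" if a: "a \<in> carrier R" "a \<noteq> \<zero>" for a n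
  proof -
    have "\<iota> a \<otimes>\<^bsub>S\<^esub> e n \<in> H n"
      using a by (auto simp: H_def)
    then have "G.tdeg (\<iota> a \<otimes>\<^bsub>S\<^esub> e n) = n"
      using a homog_eq_zero_iff by (intro G.tdegI) (auto simp: G.pr_homogeneous)
    then show ?thesis
      using a by (simp add: len_def T_e)
  qed
  have \<Omega>_mult: "\<Omega> (a \<otimes> b) = \<Omega> a + \<Omega> b" if "a \<in> carrier R" "a \<noteq> \<zero>" "b \<in> carrier R" "b \<noteq> \<zero>" for a b
    using F.factorcount_mult[of a b] that by (simp add: \<Omega>_def)
  have "\<Omega> f = 1"
    using F.factorcount_irreducible[of f] R.prime_imp_ring_irreducible[OF f_closed f_neq_zero f]
      R.ring_irreducibleE(3) f_neq_zero by (simp add: \<Omega>_def)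
  then have \<Omega>_pow: "\<Omega> (f [^] k) = k" for k :: nat
    using F.factorcount_pow[of f k] f_neq_zero by (simp add: \<Omega>_def nat_pow_mult_of)
  show ?thesis
  proof (rule G.graded_factorial[of len])
    fix x y assume "G.homogeneous x" "G.homogeneous y"
    obtain a n where a: "a \<in> carrier R" "a \<noteq> \<zero>" "x = \<iota> a \<otimes>\<^bsub>S\<^esub> e n"
      using \<open>G.homogeneous x\<close> by (rule homogeneousE)
    obtain b m where b: "b \<in> carrier R" "b \<noteq> \<zero>" "y = \<iota> b \<otimes>\<^bsub>S\<^esub> e m"
      using \<open>G.homogeneous y\<close> by (rule homogeneousE)
    note ab = a b
    have "len (x \<otimes>\<^bsub>S\<^esub> y) = 2 * (\<Omega> a + \<Omega> b + overlap n m) + nat \<bar>n + m\<bar>"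
      using ab f_pow_neq_zero by (simp add: homog_mult len \<Omega>_mult \<Omega>_pow R.integral_iff)
    \<comment> \<open>Each cancelling pair lowers the sum of the absolute values of the degrees by
      two, for which the factor \<open>f\<close> that it leaves behind makes up.\<close>
    moreover have "2 * overlap n m + nat \<bar>n + m\<bar> = nat \<bar>n\<bar> + nat \<bar>m\<bar>"
      unfolding overlap_def by (cases "n \<ge> 0"; cases "m \<ge> 0"; cases "n + m \<ge> 0") (auto simp: min_def)
    ultimately show "len (x \<otimes>\<^bsub>S\<^esub> y) = len x + len y"
      using ab by (simp add: len)
  next
    fix x assume "G.homogeneous x" "len x = 0"
    obtain a n where a: "a \<in> carrier R" "a \<noteq> \<zero>" "x = \<iota> a \<otimes>\<^bsub>S\<^esub> e n"
      using \<open>G.homogeneous x\<close> by (rule homogeneousE)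
    then have n: "\<Omega> a = 0" "n = 0"
      using len[of a n] \<open>len x = 0\<close> by auto
    then have "a \<in> Units R"
      using F.factorcount_eq_0[of a] a by (simp add: \<Omega>_def)
    then show "x \<in> Units S"
      using a n iota_Units by simp
  next
    fix x assume "G.homogeneous x" and nu: "x \<notin> Units S"
    obtain a n where a: "a \<in> carrier R" "a \<noteq> \<zero>" "x = \<iota> a \<otimes>\<^bsub>S\<^esub> e n"
      using \<open>G.homogeneous x\<close> by (rule homogeneousE)
    consider "n > 0" | "n < 0" | "n = 0" by linarith
    then show "\<exists>p\<in>carrier S. prime S p \<and> p divides\<^bsub>S\<^esub> x"
    proof cases
      case 1
      then show ?thesis
        using prime_u[OF f] u_divides_iff[OF a(1), of n] 1 a(3) by (intro bexI[of _ u]) simp_all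
    next
      case 2
      then show ?thesis
        using sw.prime_u[OF f] sw.u_divides_iff[OF a(1), of "- n"] 2 a(3) by (intro bexI[of _ v]) (simp_all add: sw_e)
    next
      case 3
      have "a \<notin> Units R"
        using nu a 3 iota_Units by auto
      then obtain p where p: "p \<in> carrier R" "p \<noteq> \<zero>" "prime R p" "p divides a"
        using F.prime_divisor_exists a by blast
      show ?thesis
      \<comment> \<open>If \<open>p\<close> does not divide \<open>f\<close>, it stays prime in
        \<open>S\<close>. Otherwise \<open>p\<close> is associated to the irreducible
        \<open>f\<close>, so \<open>f\<close> divides \<open>a\<close>, and \<open>u\<close> divides
        the image of \<open>f\<close>.\<close>
      proof (cases "p divides f")
        case False
        then show ?thesis
          using prime_iota[OF p(1-3) False] iota_divides_iff[OF p(1) a(1), of n] p(1,4) a(3) by (intro bexI[of _ "\<iota> p"]) simp_all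
      next
        case True
        then obtain c where c: "c \<in> carrier R" "f = p \<otimes> c"
          by (auto simp: factor_def)
        have "c \<in> Units R"
          using R.ring_irreducibleE(5)[OF f_closed R.prime_imp_ring_irreducible[OF f_closed f_neq_zero f] p(1) c] p(3)
          unfolding prime_def by blast
        then have "p = f \<otimes> inv c"
          using c p by (simp add: R.m_assoc)
        then have "f divides p"
          using \<open>c \<in> Units R\<close> by auto
        then have "f divides a"
          using p R.divides_trans f_closed by blast
        then show ?thesis
          using prime_u[OF f] u_divides_iff[OF a(1), of n] a(3) by (intro bexI[of _ u]) simp_all
      qed
    qed
  qed
qed

section \<open>Units and irreducibles of \<open>S\<close>; factoriality passes from \<open>S\<close>
  to \<open>R\<close>\<close>

context
  assumes f_nonunit: "f \<notin> Units R"
begin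

lemma f_factor_nonunit: "\<lbrakk>a \<in> carrier R; k > 0\<rbrakk> \<Longrightarrow> a \<otimes> f [^] (k::nat) \<noteq> \<one>"
proof
  assume a: "a \<in> carrier R" "k > 0" "a \<otimes> f [^] k = \<one>"
  then obtain l where "k = Suc l"
    by (cases k) auto
  then have "f \<otimes> (a \<otimes> f [^] l) = \<one>"
    using a by (simp add: R.m_ac)
  then show False
    using f_nonunit a R.unit_factor[of f "a \<otimes> f [^] l"] by simp
qed

text \<open>In a factorization of 1 no pair \<open>uv\<close> can cancel, as \<open>f\<close> is not
  a unit. For degrees \<open>n\<close> and \<open>- n\<close> the number of cancelling pairs is the
  absolute value of \<open>n\<close>, so both factors have degree 0.\<close>

lemma Units_S: "x \<in> Units S \<longleftrightarrow> (\<exists>a\<in>Units R. x = \<iota> a)"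
proof
  assume "x \<in> Units S"
  then obtain y where y: "x \<in> carrier S" "y \<in> carrier S" "x \<otimes>\<^bsub>S\<^esub> y = \<iota> \<one> \<otimes>\<^bsub>S\<^esub> e 0"
    by (auto simp: Units_def)
  obtain a b n m where ab: "a \<in> carrier R" "b \<in> carrier R" "x = \<iota> a \<otimes>\<^bsub>S\<^esub> e n" "n + m = 0"
    "a \<otimes> b \<otimes> f [^] overlap n m = \<one>"
    by (rule homog_factorsE[OF y(1,2) _ _ y(3)]) auto
  have "overlap n m = 0"
    using f_factor_nonunit[of "a \<otimes> b" "overlap n m"] ab by auto
  then have "n = 0" "a \<otimes> b = \<one>"
    using ab by (auto simp: overlap_def min_def split: if_splits)
  then show "\<exists>a\<in>Units R. x = \<iota> a"
    using ab R.unit_factor[of a b] by auto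
next
  assume "\<exists>a\<in>Units R. x = \<iota> a"
  then show "x \<in> Units S"
    using iota_Units by blast
qed

text \<open>In a factorization of \<open>u\<close> no pair cancels and both coefficients are units
  of \<open>R\<close>. Degrees without cancellation that add up to 1 are 0 and 1, and the factor of
  degree 0 is a unit.\<close>

lemma irreducible_u: "ring_irreducible\<^bsub>S\<^esub> u"
proof (rule G.ring_irreducibleI)
  have u: "u = \<iota> \<one> \<otimes>\<^bsub>S\<^esub> e 1"
    by (simp add: e_1)
  show "u \<in> carrier S - {\<zero>\<^bsub>S\<^esub>}"
    using homogeneous_u G.homogeneous_neq_zero by simp
  show "u \<notin> Units S"
    using Units_S[of u] homog_eq_iff[of \<one> _ 1 0] by (auto simp: e_1)
  fix x y assume xy: "x \<in> carrier S" "y \<in> carrier S" "u = x \<otimes>\<^bsub>S\<^esub> y"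
  then have "x \<otimes>\<^bsub>S\<^esub> y = \<iota> \<one> \<otimes>\<^bsub>S\<^esub> e 1"
    using u by simp
  then obtain a b n m where ab: "a \<in> carrier R" "b \<in> carrier R" "x = \<iota> a \<otimes>\<^bsub>S\<^esub> e n" "y = \<iota> b \<otimes>\<^bsub>S\<^esub> e m"
    "n + m = 1" "a \<otimes> b \<otimes> f [^] overlap n m = \<one>"
    by (rule homog_factorsE[OF xy(1,2), rotated 2]) auto
  have ov: "overlap n m = 0"
    using f_factor_nonunit[of "a \<otimes> b" "overlap n m"] ab by auto
  then have "a \<otimes> b = \<one>"
    using ab by simp
  then have "a \<in> Units R" "b \<in> Units R"
    using ab R.unit_factor[of a b] R.unit_factor[of b a] R.m_comm by auto
  moreover have "n = 0 \<or> m = 0"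
    using ov \<open>n + m = 1\<close> by (auto simp: overlap_def min_def split: if_splits)
  ultimately show "x \<in> Units S \<or> y \<in> Units S"
    using ab Units_S by auto
qed

text \<open>A cancelling pair in a factorization of \<open>\<iota> r\<close> would make
  \<open>f\<close> divide \<open>r\<close>. So both factors have degree 0, and irreducibility of
  \<open>r\<close> applies.\<close>

lemma irreducible_iota:
  assumes r: "r \<in> carrier R" "ring_irreducible r" and fr: "\<not> f divides r"
  shows "ring_irreducible\<^bsub>S\<^esub> (\<iota> r)"
proof (rule G.ring_irreducibleI)
  note rE = R.ring_irreducibleE[OF r]
  show "\<iota> r \<in> carrier S - {\<zero>\<^bsub>S\<^esub>}"
    using homogeneous_iota[OF r(1) rE(1)] G.homogeneous_neq_zero r by simp
  show "\<iota> r \<notin> Units S"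
    using Units_S[of "\<iota> r"] homog_eq_iff[of r _ 0 0] r rE(1,4) by auto
  fix x y assume xy: "x \<in> carrier S" "y \<in> carrier S" "\<iota> r = x \<otimes>\<^bsub>S\<^esub> y"
  then have "x \<otimes>\<^bsub>S\<^esub> y = \<iota> r \<otimes>\<^bsub>S\<^esub> e 0"
    using r by simp
  then obtain a b n m where ab: "a \<in> carrier R" "b \<in> carrier R" "x = \<iota> a \<otimes>\<^bsub>S\<^esub> e n" "y = \<iota> b \<otimes>\<^bsub>S\<^esub> e m"
    "n + m = 0" "a \<otimes> b \<otimes> f [^] overlap n m = r"
    by (rule homog_factorsE[OF xy(1,2), rotated 2]) (use r rE(1) in auto)
  have ov: "overlap n m = 0"
  proof (rule ccontr)
    assume "overlap n m \<noteq> 0"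
    then obtain k where "overlap n m = Suc k"
      by (cases "overlap n m") auto
    then have "r = f \<otimes> (a \<otimes> b \<otimes> f [^] k)"
      using ab by (simp add: R.m_ac)
    then show False
      using fr ab by (metis R.m_closed R.nat_pow_closed dividesI' f_closed)
  qed
  then have "n = 0" "m = 0" "r = a \<otimes> b"
    using ab by (auto simp: overlap_def min_def split: if_splits)
  then show "x \<in> Units S \<or> y \<in> Units S"
    using rE(5)[of a b] ab Units_S by auto
qed

text \<open>Primality of \<open>u\<close> and of \<open>\<iota> r\<close> in \<open>S\<close> is
  pulled back to \<open>R\<close> through \<open>u_divides_iff\<close> and
  \<open>iota_divides_iff\<close> in degree 0. An irreducible element of \<open>R\<close> divisible
  by \<open>f\<close> is associated to \<open>f\<close> and inherits its primality.\<close>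

lemma factorial_only_if:
  assumes "factorial_domain S"
  shows "factorial_domain R" "prime R f"
proof -
  interpret F: factorial_domain S by (rule assms)
  have irr_prime: "prime S x" if "x \<in> carrier S" "ring_irreducible\<^bsub>S\<^esub> x" for x
    using F.irreducible_prime[of x] G.ring_irreducibleE[OF that] G.prime_eq_prime_mult that by auto
  show f: "prime R f"
  proof (rule primeI[OF f_nonunit])
    fix a b assume ab: "a \<in> carrier R" "b \<in> carrier R" "f divides a \<otimes> b"
    have "u divides\<^bsub>S\<^esub> \<iota> a \<otimes>\<^bsub>S\<^esub> \<iota> b"
      using u_divides_iff[of "a \<otimes> b" 0] ab by (simp add: h.hom_mult)
    then have "u divides\<^bsub>S\<^esub> \<iota> a \<or> u divides\<^bsub>S\<^esub> \<iota> b"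
      using prime_dividesD[OF irr_prime[OF u_closed irreducible_u]] ab by simp
    then show "f divides a \<or> f divides b"
      using u_divides_iff[of a 0] u_divides_iff[of b 0] ab by simp
  qed
  have "prime R r" if r: "r \<in> carrier R" "ring_irreducible r" for r
  proof (cases "f divides r")
    case False
    have "prime S (\<iota> r)"
      using irr_prime irreducible_iota[OF r False] r by simp
    moreover have "\<iota> a divides\<^bsub>S\<^esub> \<iota> b \<longleftrightarrow> a divides b" if "a \<in> carrier R" "b \<in> carrier R" for a b
      using iota_divides_iff[OF that, of 0] that by simp
    ultimately show ?thesis
      using r R.ring_irreducibleE(4)[OF r] unfolding prime_def
      by (metis R.m_closed h.hom_closed h.hom_mult)
  next
    case True
    then obtain c where c: "c \<in> carrier R" "r = f \<otimes> c"
      by (auto simp: factor_def)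
    then have "c \<in> Units R"
      using R.ring_irreducibleE(5)[OF r f_closed c] f_nonunit by blast
    then have "f \<sim> r"
      using c by (intro R.associated_sym[OF R.associatedI2']) auto
    then show ?thesis
      using R.mult_of.prime_cong[of f r] R.assoc_iff_assoc_mult[of f r] R.prime_eq_prime_mult f r f_neq_zero
        R.ring_irreducibleE(1)[OF r] by simp
  qed
  then have "primeness_condition_monoid (mult_of R)"
    using R.ring_irreducibleI' R.prime_eq_prime_mult
    by (intro primeness_condition_monoid.intro primeness_condition_monoid_axioms.intro
      R.mult_of.is_comm_monoid_cancel) auto
  moreover have "divisor_chain_condition_monoid (mult_of R)"
  proof (intro divisor_chain_condition_monoid.intro divisor_chain_condition_monoid_axioms.intro
      R.mult_of.is_comm_monoid_cancel)
    let ?D = "\<lambda>G. {(x, y). x \<in> carrier G \<and> y \<in> carrier G \<and> properfactor G x y}"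
    have iota0: "\<iota> a \<noteq> \<zero>\<^bsub>S\<^esub>" if "a \<in> carrier R" "a \<noteq> \<zero>" for a
      using homogeneous_iota[OF that] G.homogeneous_neq_zero by blast
    have dvd: "\<iota> a divides\<^bsub>mult_of S\<^esub> \<iota> b \<longleftrightarrow> a divides\<^bsub>mult_of R\<^esub> b"
      if a: "a \<in> carrier R" "a \<noteq> \<zero>" and b: "b \<in> carrier R" "b \<noteq> \<zero>" for a b
    proof -
      have "\<iota> a divides\<^bsub>mult_of S\<^esub> \<iota> b \<longleftrightarrow> \<iota> a divides\<^bsub>S\<^esub> \<iota> b"
        using G.divides_imp_divides_mult[of "\<iota> a" "\<iota> b"] a(1) b iota0[OF b]
          divides_mult_imp_divides[of S "\<iota> a" "\<iota> b"] by blast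
      also have "\<dots> \<longleftrightarrow> a divides b"
        using iota_divides_iff[OF a(1) b(1), of 0] b by simp
      also have "\<dots> \<longleftrightarrow> a divides\<^bsub>mult_of R\<^esub> b"
        using R.divides_imp_divides_mult[of a b] divides_mult_imp_divides[of R a b] a(1) b by blast
      finally show ?thesis .
    qed
    \<comment> \<open>\<open>\<iota>\<close> preserves and reflects divisibility, so proper divisors
      in \<open>R\<close> map to proper divisors in \<open>S\<close>, where proper division is
      well-founded.\<close>
    have "?D (mult_of R) \<subseteq> inv_image (?D (mult_of S)) \<iota>"
      using dvd iota0 by (auto simp: properfactor_def)
    then show "wf (?D (mult_of R))"
      using wf_subset wf_inv_image F.division_wellfounded by blast
  qed
  ultimately have "factorial_monoid (mult_of R)"
    using factorial_condition_one by blast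
  then show "factorial_domain R"
    by (intro factorial_domain.intro R.domain_axioms)
qed

end

theorem factorial_iff:
  assumes "f \<notin> Units R"
  shows "factorial_domain S \<longleftrightarrow> factorial_domain R \<and> ring_prime f"
  using factorial_if factorial_only_if[OF assms] f_neq_zero by (auto simp: ring_prime_def)

end

subsection \<open>The quotient of the polynomial ring\<close>

lemma (in UP_ring) monom_induct [consumes 1, case_names monom add]:
  assumes p: "p \<in> carrier P"
    and monom: "\<And>a n. a \<in> carrier R \<Longrightarrow> Y (up_ring.monom P a n)"
    and add: "\<And>p q. \<lbrakk>p \<in> carrier P; q \<in> carrier P; Y p; Y q\<rbrakk> \<Longrightarrow> Y (p \<oplus>\<^bsub>P\<^esub> q)"
  shows "Y p"
proof -
  have "Y (\<Oplus>\<^bsub>P\<^esub>i\<in>A. up_ring.monom P (up_ring.coeff P p i) i)" if "finite A" for A :: "nat set"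
    using that
  proof (induction A rule: finite_induct)
    case empty
    then show ?case using monom[of \<zero> 0] by simp
  next
    case (insert i A)
    then show ?case
      using p monom add by (simp add: P.finsum_insert Pi_def)
  qed
  from this[of "{..deg R p}"] show ?thesis
    using up_repr[OF p] by simp
qed

locale UP_UP_cring = UP_cring R P for R (structure) and P (structure) +
  fixes f
  assumes f_closed [simp]: "f \<in> carrier R"
begin

sublocale Q: UP_cring P "UP P"
  by unfold_locales simp

abbreviation Q where "Q \<equiv> UP P"

section \<open>Monomials, coefficients and diagonal sums\<close>

definition mon where "mon a i j = up_ring.monom Q (up_ring.monom P a i) j"

lemma mon_closed [simp]: "a \<in> carrier R \<Longrightarrow> mon a i j \<in> carrier Q"
  by (simp add: mon_def)

lemma mon_mult:
  "\<lbrakk>a \<in> carrier R; b \<in> carrier R\<rbrakk> \<Longrightarrow> mon a i j \<otimes>\<^bsub>Q\<^esub> mon b k l = mon (a \<otimes> b) (i + k) (j + l)"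
  unfolding mon_def by (simp only: Q.monom_mult[symmetric] monom_mult[symmetric] monom_closed)

lemma mon_add: "\<lbrakk>a \<in> carrier R; b \<in> carrier R\<rbrakk> \<Longrightarrow> mon (a \<oplus> b) i j = mon a i j \<oplus>\<^bsub>Q\<^esub> mon b i j"
  by (simp add: mon_def)

lemma mon_one: "mon \<one> 0 0 = \<one>\<^bsub>Q\<^esub>"
  by (simp add: mon_def)

lemma mon_induct [consumes 1, case_names mon add]:
  assumes p: "p \<in> carrier Q"
    and mon: "\<And>a i j. a \<in> carrier R \<Longrightarrow> Y (mon a i j)"
    and add: "\<And>p q. \<lbrakk>p \<in> carrier Q; q \<in> carrier Q; Y p; Y q\<rbrakk> \<Longrightarrow> Y (p \<oplus>\<^bsub>Q\<^esub> q)"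
  shows "Y p"
  using p
proof (induction rule: Q.monom_induct)
  case (monom c j)
  then show ?case
  proof (induction rule: monom_induct)
    case (monom a i)
    then show ?case using mon by (simp add: mon_def)
  next
    case (add p q)
    then show ?case using assms(3) by simp
  qed
next
  case (add p q)
  then show ?case using assms(3) by blast
qed

text \<open>The first exponent is that of $u$, i.e. of the inner variable.\<close>
definition coeff2 where "coeff2 p i j = up_ring.coeff P (up_ring.coeff Q p j) i"

lemma coeff2_closed [simp]: "p \<in> carrier Q \<Longrightarrow> coeff2 p i j \<in> carrier R"
  by (simp add: coeff2_def)

text \<open>The degree $n$ coefficient of the image in $S$: each monomial $u^i v^j$ with $i - j = n$
  contributes $f^{\min(i,j)}$.\<close>
definition diag_sum :: "int \<Rightarrow> (nat \<Rightarrow> nat \<Rightarrow> 'a) \<Rightarrow> 'a" where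
  "diag_sum n p = (\<Oplus>k\<in>{..deg P p}. f [^] k \<otimes> coeff2 p (k + nat n) (k + nat (- n)))"

text \<open>Terms with \<open>k\<close> above the degree in \<open>v\<close> vanish, since the
  exponent of \<open>v\<close> is at least \<open>k\<close>. The free bound \<open>N\<close> allows
  two polynomials to be summed over a common range.\<close>

lemma diag_sum_eq:
  assumes p: "p \<in> carrier Q" and N: "deg P p \<le> N"
  shows "diag_sum n p = (\<Oplus>k\<in>{..N}. f [^] k \<otimes> coeff2 p (k + nat n) (k + nat (- n)))"
  unfolding diag_sum_def
  by (rule R.add.finprod_mono_neutral_cong_left) (use p N in \<open>auto simp: coeff2_def Q.deg_aboveD\<close>)

lemma diag_sum_closed [simp]: "p \<in> carrier Q \<Longrightarrow> diag_sum n p \<in> carrier R"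
  by (auto simp: diag_sum_def intro: R.finsum_closed)

lemma diag_sum_add:
  assumes "p \<in> carrier Q" "q \<in> carrier Q"
  shows "diag_sum n (p \<oplus>\<^bsub>Q\<^esub> q) = diag_sum n p \<oplus> diag_sum n q"
proof -
  let ?N = "max (deg P p) (deg P q)"
  have "diag_sum n (p \<oplus>\<^bsub>Q\<^esub> q) = (\<Oplus>k\<in>{..?N}. f [^] k \<otimes> coeff2 (p \<oplus>\<^bsub>Q\<^esub> q) (k + nat n) (k + nat (- n)))"
    using assms Q.deg_add by (intro diag_sum_eq) simp_all
  also have "\<dots> = (\<Oplus>k\<in>{..?N}. f [^] k \<otimes> coeff2 p (k + nat n) (k + nat (- n)) \<oplus>
      f [^] k \<otimes> coeff2 q (k + nat n) (k + nat (- n)))"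
    using assms by (intro R.finsum_cong') (auto simp: coeff2_def R.r_distr)
  also have "\<dots> = diag_sum n p \<oplus> diag_sum n q"
    using assms by (subst R.finsum_addf) (auto simp: diag_sum_eq[of p ?N] diag_sum_eq[of q ?N])
  finally show ?thesis .
qed

lemma diag_sum_mon:
  assumes a: "a \<in> carrier R"
  shows "diag_sum n (mon a i j) = (if n = int i - int j then a \<otimes> f [^] min i j else \<zero>)"
proof -
  let ?c = "if n = int i - int j then a \<otimes> f [^] min i j else \<zero>"
  have "diag_sum n (mon a i j) = (\<Oplus>k\<in>{..j}. f [^] k \<otimes> coeff2 (mon a i j) (k + nat n) (k + nat (- n)))"
    using a by (intro diag_sum_eq) (simp_all add: mon_def Q.deg_monom_le)
  also have "\<dots> = (\<Oplus>k\<in>{..j}. if min i j = k then ?c else \<zero>)"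
  proof (rule R.finsum_cong')
    fix k
    \<comment> \<open>The difference of the exponents fixes the diagonal and \<open>k\<close> the
      position on it: the monomial is met exactly once, at \<open>k = min i j\<close>.\<close>
    have "j = k + nat (- n) \<and> i = k + nat n \<longleftrightarrow> n = int i - int j \<and> min i j = k"
      by linarith
    then show "f [^] k \<otimes> coeff2 (mon a i j) (k + nat n) (k + nat (- n)) = (if min i j = k then ?c else \<zero>)"
      using a by (auto simp: coeff2_def mon_def R.m_comm)
  qed (use a in auto)
  also have "\<dots> = ?c"
    using R.finsum_singleton[of "min i j" "{..j}" "\<lambda>_. ?c"] a by simp
  finally show ?thesis .
qed

definition relator where "relator = mon \<one> 1 1 \<ominus>\<^bsub>Q\<^esub> mon f 0 0"

lemma relator_closed [simp]: "relator \<in> carrier Q"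
  by (simp add: relator_def)

lemma S_ring_eq: "S_ring R f = Q Quot (PIdl\<^bsub>Q\<^esub> relator)"
proof -
  have "var_u R = mon \<one> 1 0" "var_v R = mon \<one> 0 1" "const2 R f = mon f 0 0"
    by (simp_all add: var_u_def var_v_def const2_def mon_def flip: P_def)
  then have "relator = var_u R \<otimes>\<^bsub>Q\<^esub> var_v R \<ominus>\<^bsub>Q\<^esub> const2 R f"
    by (simp add: relator_def mon_mult)
  then show ?thesis
    by (simp add: S_ring_def flip: P_def)
qed

text \<open>By additivity \<open>q\<close> may be taken to be a monomial;
  \<open>u^(i+1) v^(j+1)\<close> and \<open>f u^i v^j\<close> lie on the same diagonal and have the
  same diagonal sum. Hence \<open>diag_sum n\<close> factors through the quotient.\<close>

lemma diag_sum_relator_mult: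
  assumes "q \<in> carrier Q"
  shows "diag_sum n (q \<otimes>\<^bsub>Q\<^esub> relator) = \<zero>"
  using assms
proof (induction rule: mon_induct)
  case (mon a i j)
  \<comment> \<open>Written as a sum, so that \<open>diag_sum_add\<close> applies directly.\<close>
  have rel: "mon \<one> 1 1 = relator \<oplus>\<^bsub>Q\<^esub> mon f 0 0"
    by (simp add: relator_def a_minus_def Q.P.a_assoc Q.P.l_neg)
  have "mon a i j \<otimes>\<^bsub>Q\<^esub> mon \<one> 1 1 = mon a i j \<otimes>\<^bsub>Q\<^esub> relator \<oplus>\<^bsub>Q\<^esub> mon a i j \<otimes>\<^bsub>Q\<^esub> mon f 0 0"
    unfolding rel using mon by (simp add: Q.P.r_distr)
  then have "mon a (i + 1) (j + 1) = mon a i j \<otimes>\<^bsub>Q\<^esub> relator \<oplus>\<^bsub>Q\<^esub> mon (a \<otimes> f) i j"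
    using mon by (simp add: mon_mult)
  then have "diag_sum n (mon a (i + 1) (j + 1)) =
      diag_sum n (mon a i j \<otimes>\<^bsub>Q\<^esub> relator) \<oplus> diag_sum n (mon (a \<otimes> f) i j)"
    using mon by (simp add: diag_sum_add)
  moreover have "diag_sum n (mon a (i + 1) (j + 1)) = diag_sum n (mon (a \<otimes> f) i j)"
    using mon by (auto simp: diag_sum_mon R.m_ac)
  ultimately have "diag_sum n (mon a i j \<otimes>\<^bsub>Q\<^esub> relator) \<oplus> diag_sum n (mon (a \<otimes> f) i j) = diag_sum n (mon (a \<otimes> f) i j)"
    by argo
  then show ?case
    using mon R.add.r_cancel_one by simp
next
  case (add p q)
  then show ?case
    by (simp add: Q.P.l_distr diag_sum_add)
qed

section \<open>The quotient ring and its coefficient maps\<close>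

abbreviation I where "I \<equiv> PIdl\<^bsub>Q\<^esub> relator"
abbreviation S where "S \<equiv> Q Quot I"
abbreviation cls where "cls p \<equiv> I +>\<^bsub>Q\<^esub> p"

lemma ideal_I: "ideal I Q"
  by (simp add: Q.P.cgenideal_ideal)

lemma cring_S: "cring S"
  by (rule ideal.quotient_is_cring[OF ideal_I Q.P.is_cring])

lemma
  shows cls_closed: "p \<in> carrier Q \<Longrightarrow> cls p \<in> carrier S"
    and cls_mult: "\<lbrakk>p \<in> carrier Q; q \<in> carrier Q\<rbrakk> \<Longrightarrow> cls (p \<otimes>\<^bsub>Q\<^esub> q) = cls p \<otimes>\<^bsub>S\<^esub> cls q"
    and cls_add: "\<lbrakk>p \<in> carrier Q; q \<in> carrier Q\<rbrakk> \<Longrightarrow> cls (p \<oplus>\<^bsub>Q\<^esub> q) = cls p \<oplus>\<^bsub>S\<^esub> cls q"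
    and cls_one: "cls \<one>\<^bsub>Q\<^esub> = \<one>\<^bsub>S\<^esub>"
  using ideal.rcos_ring_hom[OF ideal_I] by (auto dest: ring_hom_closed ring_hom_mult ring_hom_add ring_hom_one)

lemma cls_surj:
  assumes "x \<in> carrier S"
  obtains p where "p \<in> carrier Q" "x = cls p"
  using assms by (auto simp: FactRing_simps)

text \<open>The representative is arbitrary; \<open>diag_cls_eq\<close> shows that the choice is
  immaterial, because two representatives of a class differ by a multiple of
  \<open>relator\<close>.\<close>

definition diag_cls :: "int \<Rightarrow> (nat \<Rightarrow> nat \<Rightarrow> 'a) set \<Rightarrow> 'a" where
  "diag_cls n x = diag_sum n (SOME p. p \<in> carrier Q \<and> x = cls p)"

lemma diag_cls_eq:
  assumes p: "p \<in> carrier Q"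
  shows "diag_cls n (cls p) = diag_sum n p"
proof -
  define p' where "p' = (SOME p'. p' \<in> carrier Q \<and> cls p = cls p')"
  have p': "p' \<in> carrier Q" "cls p = cls p'"
    unfolding p'_def by (rule someI2[of _ p]; use p in simp)+
  have "p' \<ominus>\<^bsub>Q\<^esub> p \<in> I"
    using Q.P.quotient_eq_iff_same_a_r_cos[OF ideal_I p'(1) p] p'(2) by simp
  then obtain q where q: "q \<in> carrier Q" "p' \<ominus>\<^bsub>Q\<^esub> p = q \<otimes>\<^bsub>Q\<^esub> relator"
    by (auto simp: cgenideal_def)
  have "p' = (p' \<ominus>\<^bsub>Q\<^esub> p) \<oplus>\<^bsub>Q\<^esub> p"
    using p p' by (simp add: a_minus_def Q.P.a_assoc Q.P.l_neg)
  then have "p' = q \<otimes>\<^bsub>Q\<^esub> relator \<oplus>\<^bsub>Q\<^esub> p"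
    unfolding q(2) .
  then have "diag_sum n p' = diag_sum n p"
    using p q by (simp add: diag_sum_add diag_sum_relator_mult)
  then show ?thesis
    by (simp add: diag_cls_def p'_def)
qed

lemma mon_pow: "mon \<one> i j [^]\<^bsub>Q\<^esub> (k::nat) = mon \<one> (k * i) (k * j)"
  by (induction k) (simp_all add: mon_one mon_mult add.commute)

lemma cls_pow: "p \<in> carrier Q \<Longrightarrow> cls p [^]\<^bsub>S\<^esub> (k::nat) = cls (p [^]\<^bsub>Q\<^esub> k)"
  by (induction k) (simp_all add: cls_one cls_mult)

lemma cls_mon:
  assumes a: "a \<in> carrier R"
  shows "cls (mon a 0 0) \<otimes>\<^bsub>S\<^esub> (cls (mon \<one> 1 0) [^]\<^bsub>S\<^esub> i \<otimes>\<^bsub>S\<^esub> cls (mon \<one> 0 1) [^]\<^bsub>S\<^esub> j) = cls (mon a i j)"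
proof -
  have "cls (mon a 0 0) \<otimes>\<^bsub>S\<^esub> (cls (mon \<one> 1 0) [^]\<^bsub>S\<^esub> i \<otimes>\<^bsub>S\<^esub> cls (mon \<one> 0 1) [^]\<^bsub>S\<^esub> j) =
      cls (mon a 0 0 \<otimes>\<^bsub>Q\<^esub> (mon \<one> 1 0 [^]\<^bsub>Q\<^esub> i \<otimes>\<^bsub>Q\<^esub> mon \<one> 0 1 [^]\<^bsub>Q\<^esub> j))"
    using a by (simp add: cls_pow cls_mult)
  then show ?thesis
    using a by (simp add: mon_pow mon_mult)
qed

text \<open>\<open>diag_cls\<close> takes the role of \<open>T\<close>, and classes of monomials
  generate because every polynomial in two variables is a sum of monomials.\<close>

lemma uv_extension_quotient:
  assumes "domain R" "f \<noteq> \<zero>"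
  shows "uv_extension R S (\<lambda>a. cls (mon a 0 0)) f (cls (mon \<one> 1 0)) (cls (mon \<one> 0 1)) diag_cls"
proof -
  interpret domain R by (rule assms)
  interpret S: cring S by (rule cring_S)
  have "(\<lambda>a. cls (mon a 0 0)) \<in> ring_hom R S"
  proof (rule ring_hom_memI)
    fix a b assume ab: "a \<in> carrier R" "b \<in> carrier R"
    show "cls (mon (a \<otimes> b) 0 0) = cls (mon a 0 0) \<otimes>\<^bsub>S\<^esub> cls (mon b 0 0)"
      using ab mon_mult[OF ab, of 0 0 0 0] by (simp add: cls_mult[symmetric])
    show "cls (mon (a \<oplus> b) 0 0) = cls (mon a 0 0) \<oplus>\<^bsub>S\<^esub> cls (mon b 0 0)"
      using ab by (simp add: mon_add cls_add)
  qed (simp_all add: cls_closed mon_one cls_one)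
  then interpret hom: ring_hom_cring R S "\<lambda>a. cls (mon a 0 0)"
    by unfold_locales
  show ?thesis
  proof unfold_locales
    have "mon \<one> 1 0 \<otimes>\<^bsub>Q\<^esub> mon \<one> 0 1 \<ominus>\<^bsub>Q\<^esub> mon f 0 0 \<in> I"
      using Q.P.cgenideal_self[OF relator_closed] by (simp add: mon_mult relator_def)
    then have "cls (mon \<one> 1 0 \<otimes>\<^bsub>Q\<^esub> mon \<one> 0 1) = cls (mon f 0 0)"
      using Q.P.quotient_eq_iff_same_a_r_cos[OF ideal_I] by simp
    then show "cls (mon \<one> 1 0) \<otimes>\<^bsub>S\<^esub> cls (mon \<one> 0 1) = cls (mon f 0 0)"
      by (simp add: cls_mult)
    show "diag_cls n x \<in> carrier R" if "x \<in> carrier S" for n x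
      using that by (elim cls_surj) (simp add: diag_cls_eq)
    show "diag_cls n (x \<oplus>\<^bsub>S\<^esub> y) = diag_cls n x \<oplus> diag_cls n y" if x: "x \<in> carrier S" and y: "y \<in> carrier S" for x y n
    proof -
      obtain p where p: "p \<in> carrier Q" "x = cls p" using x by (rule cls_surj)
      obtain q where q: "q \<in> carrier Q" "y = cls q" using y by (rule cls_surj)
      show ?thesis
        using p q by (simp add: diag_cls_eq diag_sum_add flip: cls_add)
    qed
    show "diag_cls n (cls (mon a 0 0) \<otimes>\<^bsub>S\<^esub> (cls (mon \<one> 1 0) [^]\<^bsub>S\<^esub> i \<otimes>\<^bsub>S\<^esub> cls (mon \<one> 0 1) [^]\<^bsub>S\<^esub> j)) =
        (if n = int i - int j then a \<otimes> f [^] min i j else \<zero>)" if "a \<in> carrier R" for a n i j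
      using that by (simp only: cls_mon diag_cls_eq mon_closed diag_sum_mon)
    show "x \<in> Y" if x: "x \<in> carrier S"
        and mon: "\<And>a i j. a \<in> carrier R \<Longrightarrow> cls (mon a 0 0) \<otimes>\<^bsub>S\<^esub>
          (cls (mon \<one> 1 0) [^]\<^bsub>S\<^esub> (i::nat) \<otimes>\<^bsub>S\<^esub> cls (mon \<one> 0 1) [^]\<^bsub>S\<^esub> (j::nat)) \<in> Y"
        and add: "\<And>y z. \<lbrakk>y \<in> Y; z \<in> Y\<rbrakk> \<Longrightarrow> y \<oplus>\<^bsub>S\<^esub> z \<in> Y" for x Y
    proof -
      obtain p where p: "p \<in> carrier Q" "x = cls p" using x by (rule cls_surj)
      have "cls p \<in> Y"
        using p(1)
      proof (induction rule: mon_induct)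
        case (mon a i j)
        then show ?case using that(2)[of a i j] by (simp only: cls_mon)
      next
        case (add p q)
        then show ?case using that(3)[of "cls p" "cls q"] by (simp add: cls_add)
      qed
      then show ?thesis using p by simp
    qed
  qed (simp_all add: assms cls_closed)
qed

end

theorem theorem2p1:
  fixes R :: "('a, 'm) ring_scheme" and f :: 'a
  assumes "domain R"
    and "f \<in> carrier R" and "f \<noteq> \<zero>\<^bsub>R\<^esub>" and "f \<notin> Units R"
  shows "factorial_domain (S_ring R f) \<longleftrightarrow> factorial_domain R \<and> ring_prime\<^bsub>R\<^esub> f"
proof -
  interpret domain R by (rule assms)
  interpret UP_UP_cring R "UP R" f
    by unfold_locales (simp_all add: assms)
  show ?thesis
    unfolding S_ring_eq by (rule uv_extension.factorial_iff[OF uv_extension_quotient]) (use assms in simp_all)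
qed

end
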